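(* Let $p$ be a prime, $m\ge 0$ an integer, and $S$ a scheme flat over $\mathbb{Z}/p^{m+1}\mathbb{Z}$ whose reduction $S_0$ modulo $p$ is isomorphic to $\mathrm{Spec}(R)$ for a local ring $(R,\mathfrak m)$ over $\mathbb{F}_p$ whose residue field $R/\mathfrak m$ is algebraically closed. Let $\mathscr F=(\mathcal F,\nabla)$ be a dormant flat bundle on $U_{\oslash}^{\log}/S$ of rank $n>0$. Then there exists an isomorphism of flat bundles $$\bigoplus_{i=1}^n \mathscr O_{\oslash,d_i}\ \xrightarrow{\ \sim\ }\ \mathscr F$$ for some $d_1,\dots,d_n\in\mathbb{Z}/p^{m+1}\mathbb{Z}$. In particular, the monodromy operator $\mu(\nabla)$ of $\nabla$ can be transformed, via conjugation (i.e. after a suitable trivialization of its underlying module), into the diagonal matrix with diagonal entries $-d_1,\dots,-d_n$, and the resulting multiset $[d_1,\dots,d_n]$ depends only on the isomorphism class of $\mathscr F$.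
   Context: $U=U_\oslash=\mathrm{Spec}(\mathcal O_S[[t]])$ (relative spectrum), with the log structure defined by the divisor $t=0$; $\mathcal O_\oslash=\mathcal O_{U}$, and $\Omega=\mathcal O_\oslash\cdot\frac{dt}{t}$ is the module of logarithmic $1$-forms over $S$. A flat bundle on $U_\oslash^{\log}/S$ is a vector bundle $\mathcal F$ on $U$ with an $\mathcal O_S$-linear connection $\nabla:\mathcal F\to\Omega\otimes\mathcal F$ (Leibniz rule with respect to the universal derivation $D:\mathcal{O}_\oslash\to\Omega$); write $\nabla(v)=\frac{dt}{t}\otimes\delta_\nabla(v)$. The monodromy operator $\mu(\nabla)$ is the $\mathcal O_S$-linear endomorphism of $\mathcal F|_{t=0}$ induced by $\delta_\nabla$. For $d\in\mathbb{Z}/p^{m+1}\mathbb{Z}$, $\mathscr O_{\oslash,d}=(\mathcal O_\oslash,\nabla_{\oslash,d})$ with $\nabla_{\oslash,d}(v)=D(v)-d\,v\,\frac{dt}{t}$. Subscript $a$ denotes reduction modulo $p^{a+1}$. For $a\ge0$ put $q_j=\lfloor j/p^a\rfloor$, and let $\mathcal D_0^{(a)}$ be the ring of logarithmic differential operators of level $a$ on $U_0$: the free left $\mathcal O_{U_0}$-module on symbols $\partial^{\langle j\rangle}$ ($j\ge 0$), acting on $\mathcal O_{U_0}$ by $\partial^{\langle j\rangle}(t^k)=q_j!\binom{k}{j}t^k$, with $\partial^{\langle j\rangle}h=\sum_{i+i'=j}\frac{q_j!}{q_i!q_{i'}!}\partial^{\langle i\rangle}(h)\,\partial^{\langle i'\rangle}$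 for $h\in\mathcal O_{U_0}$, and $$\partial^{\langle j'\rangle}\partial^{\langle j''\rangle}=\sum_{j=\max\{j',j''\}}^{j'+j''}\frac{j!}{(j'+j''-j)!\,(j-j')!\,(j-j'')!}\cdot\frac{q_{j'}!\,q_{j''}!}{q_j!}\,\partial^{\langle j\rangle}.$$ The natural ring map $\mathcal D_0^{(a-1)}\to\mathcal D_0^{(a)}$, $\partial^{\langle j\rangle}\mapsto \frac{\lfloor j/p^{a-1}\rfloor!}{\lfloor j/p^{a}\rfloor!}\partial^{\langle j\rangle}$, is used to reduce the level of module structures. A $\mathcal D_0^{(0)}$-module structure on an $\mathcal O_{U_0}$-module $\mathcal F_0$ is the same as an $\mathcal O_{S_0}$-linear connection $\nabla:\mathcal F_0\to\Omega_0\otimes\mathcal F_0$ satisfying the Leibniz rule with respect to the universal derivation $\mathcal O_{U_0}\to\Omega_0=\mathcal O_{U_0}\cdot\frac{dt}{t}$ ($\partial^{\langle1\rangle}$ acting as $\delta_\nabla$, where $\nabla(v)=\frac{dt}{t}\otimes\delta_\nabla(v)$). Dormancy is defined inductively, together with a $\mathcal D_0^{(a)}$-module structure (the "diagonal reduction") on the mod $p$ reduction $\mathcal F_0$ of a dormant flat bundle over $S_a$. For $a=0$: $(\mathcal F_0,\nabla_0)$ is dormant if its $p$-curvature vanishes, i.e. $\delta_\nabla^p=\delta_\nabla$; its diagonal reduction is itself. For $a\ge1$: let $(\mathcal F,\nabla)$ be a flat bundle over $S_a$ whose reduction modulo $p^a$ is dormant, with diagonal reduction $\nabla_0^{(a-1)}$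 (a $\mathcal D_0^{(a-1)}$-module structure on $\mathcal F_0$). Let $\mathcal V\subseteq\mathcal F_0$ be the subsheaf of sections killed by all $\partial^{\langle j\rangle}\in\mathcal D_0^{(a-1)}$, $j\ge1$. Each local section $v$ of $\mathcal V$ has locally a lift $\tilde v\in\mathcal F$ with $\delta_\nabla(\tilde v)\in p^a\mathcal F\cong\mathcal F_0$; put $$\delta_{\mathcal V}(v)=\prod_{b=0}^{a-1}\bigl(1-(\partial^{\langle p^b\rangle})^{p-1}\bigr)\Bigl(\tfrac1{p^a}\delta_\nabla(\tilde v)\Bigr)\in\mathcal V,$$ which is independent of $\tilde v$ (this is the composite of the logarithmic Cartier operators of the successive levels applied to $\frac1{p^a}\nabla(\tilde v)$). Then $(\mathcal F,\nabla)$ is dormant if there is a $\mathcal D_0^{(a)}$-module structure on $\mathcal F_0$ whose reduction to level $a-1$ is $\nabla_0^{(a-1)}$, for which $\partial^{\langle p^a\rangle}$ acts on $\mathcal V$ as $\delta_{\mathcal V}$, and $\delta_{\mathcal V}^p=\delta_{\mathcal V}$ (vanishing $p$-curvature); this $\mathcal D_0^{(a)}$-module structure is unique and is the diagonal reduction. A flat bundle over $S=S_m$ is dormant if this holds for $a=m$. *)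

theory Defs
  imports
    "HOL-Analysis.Analysis"
    "HOL-Algebra.Algebraic_Closure_Type"
    "HOL-Number_Theory.Number_Theory"
begin

section \<open>Flat modules and local rings\<close>

text \<open>
  Finite formal sums of symbols n \<open>\<otimes>\<close> x, with n in a module N over the ring B and x in an abelian
  group on which B acts by \<open>act\<close>, are represented by multisets of pairs. Two formal sums are
  related iff they define the same element of the tensor product over B. Negatives are not
  needed, as -(n \<open>\<otimes>\<close> x) = (-n) \<open>\<otimes>\<close> x.
\<close>

inductive tensor_eq ::
  "'b ring \<Rightarrow> ('b, 'u) module \<Rightarrow> ('b \<Rightarrow> 'a \<Rightarrow> 'a::ab_group_add) \<Rightarrow>
    ('u \<times> 'a) multiset \<Rightarrow> ('u \<times> 'a) multiset \<Rightarrow> bool"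
  for B :: "'b ring" and N :: "('b, 'u) module" and act :: "'b \<Rightarrow> 'a \<Rightarrow> 'a::ab_group_add"
where
  refl: "tensor_eq B N act u u"
| sym: "tensor_eq B N act u v \<Longrightarrow> tensor_eq B N act v u"
| trans: "tensor_eq B N act u v \<Longrightarrow> tensor_eq B N act v w \<Longrightarrow> tensor_eq B N act u w"
| plus: "tensor_eq B N act u v \<Longrightarrow> tensor_eq B N act u' v' \<Longrightarrow> tensor_eq B N act (u + u') (v + v')"
| zero: "tensor_eq B N act {#(\<zero>\<^bsub>N\<^esub>, x)#} {#}"
| add_left: "n \<in> carrier N \<Longrightarrow> n' \<in> carrier N \<Longrightarrow>
    tensor_eq B N act {#(n \<oplus>\<^bsub>N\<^esub> n', x)#} {#(n, x), (n', x)#}"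
| add_right: "n \<in> carrier N \<Longrightarrow>
    tensor_eq B N act {#(n, x + x')#} {#(n, x), (n, x')#}"
| balanced: "b \<in> carrier B \<Longrightarrow> n \<in> carrier N \<Longrightarrow>
    tensor_eq B N act {#(b \<odot>\<^bsub>N\<^esub> n, x)#} {#(n, act b x)#}"

text \<open>
  Flatness: tensoring preserves injectivity of linear maps f from N' to N. The modules N' and N
  have their carriers in the type of B. For B = Z/q this type is the type of integers, so that all
  countable (in particular all finitely generated) B-modules are covered, which suffices, because
  an element of a tensor product and its vanishing involve only finitely many elements.
\<close>

definition flat_module :: "'b ring \<Rightarrow> ('b \<Rightarrow> 'a \<Rightarrow> 'a::ab_group_add) \<Rightarrow> bool" where
  "flat_module B act \<longleftrightarrow>
    (\<forall>(N' :: ('b, 'b) module) (N :: ('b, 'b) module) f.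
      Module.module B N' \<and> Module.module B N \<and>
      f \<in> carrier N' \<rightarrow> carrier N \<and> inj_on f (carrier N') \<and>
      (\<forall>x\<in>carrier N'. \<forall>y\<in>carrier N'. f (x \<oplus>\<^bsub>N'\<^esub> y) = f x \<oplus>\<^bsub>N\<^esub> f y) \<and>
      (\<forall>b\<in>carrier B. \<forall>x\<in>carrier N'. f (b \<odot>\<^bsub>N'\<^esub> x) = b \<odot>\<^bsub>N\<^esub> f x) \<longrightarrow>
      (\<forall>u v. set_mset u \<subseteq> carrier N' \<times> UNIV \<longrightarrow> set_mset v \<subseteq> carrier N' \<times> UNIV \<longrightarrow>
        tensor_eq B N act (image_mset (map_prod f id) u) (image_mset (map_prod f id) v) \<longrightarrow>
        tensor_eq B N' act u v))"

definition local_ring :: "'r::comm_ring_1 set \<Rightarrow> bool" where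
  "local_ring \<mm> \<longleftrightarrow>
    maximalideal \<mm> ring_of_type_algebra \<and>
    (\<forall>J. maximalideal J (ring_of_type_algebra :: 'r ring) \<longrightarrow> J = \<mm>)"


section \<open>Vector bundles, restriction, and flat bundles\<close>

text \<open>
  The images in the localization at f of elements \<open>e 0, \<dots>, e (n - 1)\<close> of the module form a basis;
  every basis of the localization becomes one of this form after multiplication by powers of f.
\<close>

definition free_at :: "('c::comm_ring_1 \<Rightarrow> 'm::ab_group_add \<Rightarrow> 'm) \<Rightarrow> nat \<Rightarrow> 'c \<Rightarrow> bool" where
  "free_at s n f \<longleftrightarrow>
    (\<exists>e :: nat \<Rightarrow> 'm.
      (\<forall>v. \<exists>k c. s (f ^ k) v = (\<Sum>i<n. s (c i) (e i))) \<and>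
      (\<forall>c. (\<Sum>i<n. s (c i) (e i)) = 0 \<longrightarrow> (\<exists>k. \<forall>i<n. f ^ k * c i = 0)))"

text \<open>
  A vector bundle of rank n on an affine scheme, given by its module of global sections: free of
  rank n on the members of a cover by basic open sets.
\<close>

definition vector_bundle :: "('c::comm_ring_1 \<Rightarrow> 'm::ab_group_add \<Rightarrow> 'm) \<Rightarrow> nat \<Rightarrow> bool" where
  "vector_bundle s n \<longleftrightarrow>
    Modules.module s \<and> (\<exists>C. 1 \<in> module.span (*) C \<and> (\<forall>f\<in>C. free_at s n f))"

text \<open>
  The map r exhibits N as the restriction of M to the closed subscheme defined by the surjective
  ring homomorphism \<open>\<phi>\<close>, i.e. as the quotient of M by the submodule \<open>(ker \<phi>) M\<close>.
\<close>

definition is_restriction ::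
  "('c::comm_ring_1 \<Rightarrow> 'd::comm_ring_1) \<Rightarrow> ('c \<Rightarrow> 'm::ab_group_add \<Rightarrow> 'm) \<Rightarrow>
    ('d \<Rightarrow> 'v::ab_group_add \<Rightarrow> 'v) \<Rightarrow> ('m \<Rightarrow> 'v) \<Rightarrow> bool" where
  "is_restriction \<phi> s s' r \<longleftrightarrow>
    Modules.module s \<and> Modules.module s' \<and> Modules.additive r \<and> (\<forall>f v. r (s f v) = s' (\<phi> f) (r v)) \<and>
    surj r \<and> (\<forall>v. r v = 0 \<longleftrightarrow> v \<in> module.span s {s f w | f w. \<phi> f = 0})"

definition fps_map :: "('a::zero \<Rightarrow> 'r::zero) \<Rightarrow> 'a fps \<Rightarrow> 'r fps" where
  "fps_map \<pi> f = Abs_fps (\<lambda>k. \<pi> (fps_nth f k))"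

text \<open>The universal derivation is D f = \<open>log_deriv f\<close> dt/t, that is, \<open>log_deriv\<close> is t d/dt.\<close>

definition log_deriv :: "'a::comm_ring_1 fps \<Rightarrow> 'a fps" where
  "log_deriv f = fps_X * fps_deriv f"

text \<open>
  As the module of logarithmic forms is free on dt/t, a connection \<open>\<nabla>\<close> is given by the
  endomorphism \<open>\<delta>\<close> with \<open>\<nabla> v = dt/t \<otimes> \<delta> v\<close>.
\<close>

definition log_connection ::
  "('a::comm_ring_1 fps \<Rightarrow> 'm::ab_group_add \<Rightarrow> 'm) \<Rightarrow> ('m \<Rightarrow> 'm) \<Rightarrow> bool" where
  "log_connection s \<delta> \<longleftrightarrow>
    Modules.additive \<delta> \<and> (\<forall>c v. \<delta> (s (fps_const c) v) = s (fps_const c) (\<delta> v)) \<and>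
    (\<forall>h v. \<delta> (s h v) = s (log_deriv h) v + s h (\<delta> v))"

definition flat_bundle ::
  "('a::comm_ring_1 fps \<Rightarrow> 'm::ab_group_add \<Rightarrow> 'm) \<Rightarrow> ('m \<Rightarrow> 'm) \<Rightarrow> nat \<Rightarrow> bool" where
  "flat_bundle s \<delta> n \<longleftrightarrow> vector_bundle s n \<and> log_connection s \<delta>"

definition flat_bundle_iso ::
  "('a::comm_ring_1 fps \<Rightarrow> 'm::ab_group_add \<Rightarrow> 'm) \<Rightarrow> ('m \<Rightarrow> 'm) \<Rightarrow>
    ('a fps \<Rightarrow> 'l::ab_group_add \<Rightarrow> 'l) \<Rightarrow> ('l \<Rightarrow> 'l) \<Rightarrow> ('m \<Rightarrow> 'l) \<Rightarrow> bool" where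
  "flat_bundle_iso s \<delta> s' \<delta>' \<psi> \<longleftrightarrow>
    module_hom s s' \<psi> \<and> bij \<psi> \<and> (\<forall>v. \<psi> (\<delta> v) = \<delta>' (\<psi> v))"

text \<open>The operator of the rank one flat bundle attached to the residue class of d.\<close>

definition delta_rank1 :: "nat \<Rightarrow> 'a::comm_ring_1 fps \<Rightarrow> 'a fps" where
  "delta_rank1 d f = log_deriv f - of_nat d * f"

definition delta_sum :: "('n \<Rightarrow> nat) \<Rightarrow> ('a::comm_ring_1 fps)^'n::finite \<Rightarrow> ('a fps)^'n" where
  "delta_sum d v = (\<chi> i. delta_rank1 (d i) (v $ i))"

text \<open>
  The endomorphism of the fibre at t = 0 induced by \<open>\<delta>\<close>, where r is the restriction map to t = 0;
  \<open>inv_into UNIV r x\<close> is an arbitrary preimage of x.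
\<close>

definition monodromy :: "('m \<Rightarrow> 'f) \<Rightarrow> ('m \<Rightarrow> 'm) \<Rightarrow> 'f \<Rightarrow> 'f" where
  "monodromy r \<delta> x = r (\<delta> (inv_into UNIV r x))"


section \<open>Logarithmic differential operators of finite level\<close>

text \<open>
  The image of a p-integral rational number in a ring of characteristic p. Some of the coefficients
  in the composition rule below are p-integral but not integral.
\<close>

definition of_plocal :: "nat \<Rightarrow> rat \<Rightarrow> 'r::comm_ring_1" where
  "of_plocal p c =
    of_int (fst (quotient_of c) * modular_inverse (int p) (snd (quotient_of c)))"

text \<open>The factorial of the floor of \<open>j / p\<^sup>a\<close>.\<close>

definition qfact :: "nat \<Rightarrow> nat \<Rightarrow> nat \<Rightarrow> rat" where
  "qfact p a j = fact (j div p ^ a)"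

definition diffop_action :: "nat \<Rightarrow> nat \<Rightarrow> nat \<Rightarrow> 'r::comm_ring_1 fps \<Rightarrow> 'r fps" where
  "diffop_action p a j h =
    Abs_fps (\<lambda>k. of_plocal p (qfact p a j * of_nat (k choose j)) * fps_nth h k)"

text \<open>
  A structure of module over the ring of operators of level a, compatible with the given module
  structure s over the ring of functions, is given by the actions \<open>E j\<close> of the generators, since
  that ring is free over the functions on the generators, and its multiplication is determined by
  the two commutation rules (the generator of index 0 is the unit).
\<close>

definition D_module ::
  "nat \<Rightarrow> nat \<Rightarrow> ('r::comm_ring_1 fps \<Rightarrow> 'v::ab_group_add \<Rightarrow> 'v) \<Rightarrow> (nat \<Rightarrow> 'v \<Rightarrow> 'v) \<Rightarrow> bool" where
  "D_module p a s E \<longleftrightarrow>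
    (\<forall>j. Modules.additive (E j)) \<and> E 0 = id \<and>
    (\<forall>j h v. E j (s h v) =
      (\<Sum>i\<le>j. s (fps_const (of_plocal p (qfact p a j / (qfact p a i * qfact p a (j - i)))) *
                   diffop_action p a i h) (E (j - i) v))) \<and>
    (\<forall>j1 j2 v. E j1 (E j2 v) =
      (\<Sum>j = max j1 j2..j1 + j2.
        s (fps_const (of_plocal p
             (fact j / (fact (j1 + j2 - j) * fact (j - j1) * fact (j - j2)) *
              (qfact p a j1 * qfact p a j2 / qfact p a j)))) (E j v)))"

text \<open>The structure E of level a + 1 reduces to the structure E' of level a.\<close>

definition level_reduction ::
  "nat \<Rightarrow> nat \<Rightarrow> ('r::comm_ring_1 fps \<Rightarrow> 'v \<Rightarrow> 'v) \<Rightarrow> (nat \<Rightarrow> 'v \<Rightarrow> 'v) \<Rightarrow> (nat \<Rightarrow> 'v \<Rightarrow> 'v) \<Rightarrow> bool"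
where
  "level_reduction p a s E E' \<longleftrightarrow>
    (\<forall>j v. E' j v = s (fps_const (of_plocal p (qfact p a j / qfact p (Suc a) j))) (E j v))"

definition horizontal :: "(nat \<Rightarrow> 'v \<Rightarrow> 'v::zero) \<Rightarrow> 'v set" where
  "horizontal E = {v. \<forall>j\<ge>1. E j v = 0}"


section \<open>Dormant flat bundles\<close>

text \<open>
  The flat bundle is given on the top level by the module with scalar multiplication s and the
  operator \<open>\<delta>\<close>, and r is the reduction modulo p. The reduction modulo \<open>p\<^sup>a\<^sup>+\<^sup>1\<close> is treated
  by representatives: x represents a lift of v to that reduction, and \<open>\<delta> x = p\<^sup>a y\<close> holds there,
  so that r y corresponds to \<open>\<delta> x\<close> divided by \<open>p\<^sup>a\<close>.
\<close>

definition lift_pair ::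
  "nat \<Rightarrow> ('a::comm_ring_1 fps \<Rightarrow> 'm::ab_group_add \<Rightarrow> 'm) \<Rightarrow> ('m \<Rightarrow> 'm) \<Rightarrow> ('m \<Rightarrow> 'v) \<Rightarrow>
    nat \<Rightarrow> 'v \<Rightarrow> 'm \<times> 'm \<Rightarrow> bool" where
  "lift_pair p s \<delta> r a v = (\<lambda>(x, y).
    r x = v \<and> (\<exists>z. \<delta> x = s (of_nat (p ^ a)) y + s (of_nat (p ^ (a + 1))) z))"

text \<open>The composite of the logarithmic Cartier operators of the levels b < a.\<close>

primrec cartier :: "nat \<Rightarrow> (nat \<Rightarrow> 'v \<Rightarrow> 'v::ab_group_add) \<Rightarrow> nat \<Rightarrow> 'v \<Rightarrow> 'v" where
  "cartier p E 0 v = v"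
| "cartier p E (Suc b) v =
    cartier p E b v - ((E (p ^ b)) ^^ (p - 1)) (cartier p E b v)"

text \<open>The operator \<open>\<delta>\<^sub>V\<close>, computed from an arbitrary choice of a lift.\<close>

definition delta_hor ::
  "nat \<Rightarrow> ('a::comm_ring_1 fps \<Rightarrow> 'm::ab_group_add \<Rightarrow> 'm) \<Rightarrow> ('m \<Rightarrow> 'm) \<Rightarrow>
    ('m \<Rightarrow> 'v::ab_group_add) \<Rightarrow> nat \<Rightarrow> (nat \<Rightarrow> 'v \<Rightarrow> 'v) \<Rightarrow> 'v \<Rightarrow> 'v" where
  "delta_hor p s \<delta> r a E v = cartier p E a (r (snd (SOME xy. lift_pair p s \<delta> r a v xy)))"

text \<open>
  The reduction of the flat bundle modulo \<open>p\<^sup>a\<^sup>+\<^sup>1\<close> is dormant, and its diagonal reduction is the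
  structure E of level a on the reduction modulo p, which has scalar multiplication \<open>s\<^sub>0\<close>.
  For a = 0, \<open>E 1\<close> is the reduction of \<open>\<delta>\<close>, and E is the corresponding structure of level 0.
\<close>

primrec diagonal_reduction ::
  "nat \<Rightarrow> ('a::comm_ring_1 fps \<Rightarrow> 'm::ab_group_add \<Rightarrow> 'm) \<Rightarrow> ('m \<Rightarrow> 'm) \<Rightarrow>
    ('r::comm_ring_1 fps \<Rightarrow> 'v::ab_group_add \<Rightarrow> 'v) \<Rightarrow> ('m \<Rightarrow> 'v) \<Rightarrow>
    nat \<Rightarrow> (nat \<Rightarrow> 'v \<Rightarrow> 'v) \<Rightarrow> bool" where
  "diagonal_reduction p s \<delta> s\<^sub>0 r 0 E \<longleftrightarrow>
    D_module p 0 s\<^sub>0 E \<and> (\<forall>x. E 1 (r x) = r (\<delta> x)) \<and> (\<forall>v. (E 1 ^^ p) v = E 1 v)"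
| "diagonal_reduction p s \<delta> s\<^sub>0 r (Suc b) E \<longleftrightarrow>
    (\<exists>E'. diagonal_reduction p s \<delta> s\<^sub>0 r b E' \<and>
      D_module p (Suc b) s\<^sub>0 E \<and> level_reduction p b s\<^sub>0 E E' \<and>
      (\<forall>v\<in>horizontal E'. E (p ^ Suc b) v = delta_hor p s \<delta> r (Suc b) E' v) \<and>
      (\<forall>v\<in>horizontal E'.
        (delta_hor p s \<delta> r (Suc b) E' ^^ p) v = delta_hor p s \<delta> r (Suc b) E' v))"

definition dormant ::
  "nat \<Rightarrow> nat \<Rightarrow> ('a::comm_ring_1 fps \<Rightarrow> 'm::ab_group_add \<Rightarrow> 'm) \<Rightarrow> ('m \<Rightarrow> 'm) \<Rightarrow>
    ('r::comm_ring_1 fps \<Rightarrow> 'v::ab_group_add \<Rightarrow> 'v) \<Rightarrow> ('m \<Rightarrow> 'v) \<Rightarrow> bool" where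
  "dormant p m s \<delta> s\<^sub>0 r \<longleftrightarrow> (\<exists>E. diagonal_reduction p s \<delta> s\<^sub>0 r m E)"

end

theory Submission
  imports Defs
begin

text \<open>
  Let M be the module of sections. A section x with \<open>\<delta> x \<in> p\<^sup>a M\<close> reduces to a section
  v of the horizontal part V of level a - 1, and \<open>\<delta>\<^sub>V\<^sup>p = \<delta>\<^sub>V\<close> splits v into eigenvectors
  of \<open>\<delta>\<^sub>V\<close> with eigenvalues \<open>c < p\<close>. As the kernel of the composite of the Cartier operators
  consists of the errors that can be absorbed into a change of the lift by a multiple of p, each of them
  lifts to some \<open>x'\<close> with \<open>\<delta> x' \<equiv> c p\<^sup>a x'\<close> modulo \<open>p\<^sup>a\<^sup>+\<^sup>1\<close>. All of this respects the submodules
  \<open>t\<^sup>k M\<close>, so that an eigenvector modulo \<open>p\<^sup>a\<close> of arbitrary eigenvalue can be treated after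
  multiplication by a power of t. By induction on a, the module M is spanned by eigenvectors of
  \<open>\<delta>\<close>; as the base ring is local, a basis can be chosen among them.

  For uniqueness, an isomorphism restricts at t = 0 to an invertible matrix G over the base with
  \<open>(d\<^sub>j - d'\<^sub>i) G\<^sub>i\<^sub>j = 0\<close>, and by locality some term of the expansion of its determinant is a unit.
\<close>

section \<open>Operators satisfying \<open>T\<^sup>p = T\<close>\<close>

text \<open>The dormancy data speak only of sections x with \<delta> x in p^a M, that is, of the
  eigenvalue 0 modulo p^a, whereas the induction meets every residue c. Since \<delta>(t^k x) = t^k
  (\<delta> + k) x, the factor t^k with k = c (p^a - 1) turns the eigenvalue c into c p^a. This
  replaces a twist by a bundle of rank one, whose diagonal reduction would have to be constructed.
  The price is that t is not invertible: every lift and every correction must again be divisible by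
  t^k. This works because the operators are logarithmic (each generator maps t^k to a constant
  multiple of itself) and because t^k M meets p M only in p t^k M. Flatness enters in the form: p x
  = 0 forces x into p^m M. Division by p thus leaves an error in p^m M, which below the top level is
  invisible modulo p even after division by p^b; this makes the horizontal operator independent of
  the lift. Only the operators of index p^b stay in play: they alone determine horizontality, and
  they pass unchanged through the reduction of levels.\<close>

text \<open>Telescoping (c+1)^(k+1) - c^(k+1) over c < p writes p^(k+1) as a combination of the
  power sums of exponent at most k. The last coefficient k + 1 is prime to p, so induction
  applies.\<close>

lemma prime_dvd_sum_of_powers:
  assumes p: "Factorial_Ring.prime (p::nat)" and k: "k < p - 1"
  shows "int p dvd (\<Sum>c<p. int c ^ k)"
  using k
proof (induction k rule: less_induct)
  case (less k)
  define S where "S i = (\<Sum>c<p. int c ^ i)" for i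
  have step_eq: "(int c + 1) ^ Suc k - int c ^ Suc k = (\<Sum>i\<le>k. of_nat (Suc k choose i) * int c ^ i)" for c
  proof -
    have "(int c + 1) ^ Suc k = (\<Sum>i\<le>Suc k. of_nat (Suc k choose i) * int c ^ i)"
      using binomial_ring[of "int c" 1 "Suc k"] by simp
    then show ?thesis by simp
  qed
  have "int p ^ Suc k = (\<Sum>c<p. (int c + 1) ^ Suc k - int c ^ Suc k)"
    using sum_lessThan_telescope[of "\<lambda>c. int c ^ Suc k" p] by (simp add: add.commute)
  also have "\<dots> = (\<Sum>c<p. \<Sum>i\<le>k. of_nat (Suc k choose i) * int c ^ i)"
    by (rule sum.cong[OF HOL.refl step_eq])
  also have "\<dots> = (\<Sum>i\<le>k. of_nat (Suc k choose i) * S i)"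
    unfolding S_def sum_distrib_left by (rule sum.swap)
  also have "\<dots> = (\<Sum>i<k. of_nat (Suc k choose i) * S i) + int (Suc k) * S k"
    by (simp add: lessThan_Suc_atMost[symmetric])
  finally have eq: "int p ^ Suc k = (\<Sum>i<k. of_nat (Suc k choose i) * S i) + int (Suc k) * S k" .
  have "int p dvd (\<Sum>i<k. of_nat (Suc k choose i) * S i)"
    using less by (intro dvd_sum dvd_mult) (auto simp: S_def)
  moreover have "int p dvd int p ^ Suc k" by simp
  ultimately have "int p dvd int (Suc k) * S k"
    unfolding eq by (simp only: dvd_add_right_iff)
  moreover have "\<not> int p dvd int (Suc k)"
    using less.prems by (simp only: int_dvd_int_iff) (auto dest!: dvd_imp_le)
  moreover have "Factorial_Ring.prime (int p)" using p by simp
  ultimately show ?case by (auto simp: prime_dvd_mult_iff S_def)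
qed

lemma (in Modules.additive) scale_of_nat:
  assumes "Modules.module s" "Modules.module s'"
  shows "f (s (of_nat k) x) = s' (of_nat k) (f x)"
proof -
  interpret a: Modules.module s by fact
  interpret b: Modules.module s' by fact
  show ?thesis
    by (induction k) (simp_all add: zero add a.scale_left_distrib b.scale_left_distrib)
qed

lemma additive_funpow:
  fixes T :: "'v::ab_group_add \<Rightarrow> 'v"
  assumes "Modules.additive T"
  shows "Modules.additive (T ^^ n)"
proof -
  interpret Modules.additive T by fact
  have "(T ^^ n) (x + y) = (T ^^ n) x + (T ^^ n) y" for x y
    by (induction n) (simp_all add: add)
  then show ?thesis by unfold_locales
qed

text \<open>Apart from nonemptiness this is an additive subgroup. Horizontal sections form one, but
  in general no module over the functions.\<close>

definition subtraction_closed :: "'v::ab_group_add set \<Rightarrow> bool" where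
  "subtraction_closed V \<longleftrightarrow> (\<forall>x\<in>V. \<forall>y\<in>V. x - y \<in> V)"

lemma subtraction_closedD: "subtraction_closed V \<Longrightarrow> x \<in> V \<Longrightarrow> y \<in> V \<Longrightarrow> x - y \<in> V"
  by (simp add: subtraction_closed_def)

lemma subtraction_closed_zero: "subtraction_closed V \<Longrightarrow> x \<in> V \<Longrightarrow> 0 \<in> V"
  using subtraction_closedD[of V x x] by simp

lemma subtraction_closed_minus: "subtraction_closed V \<Longrightarrow> x \<in> V \<Longrightarrow> - x \<in> V"
  using subtraction_closedD[of V 0 x] subtraction_closed_zero by fastforce

lemma subtraction_closed_add: "subtraction_closed V \<Longrightarrow> x \<in> V \<Longrightarrow> y \<in> V \<Longrightarrow> x + y \<in> V"
  using subtraction_closedD[of V x "- y"] subtraction_closed_minus by fastforce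

lemma subtraction_closed_sum:
  assumes "subtraction_closed V" "0 \<in> V" "\<And>i. i \<in> I \<Longrightarrow> f i \<in> V"
  shows "sum f I \<in> V"
  using assms(3) by (induction I rule: infinite_finite_induct)
    (auto intro: assms subtraction_closed_add)

lemma subtraction_closed_scale_of_nat:
  assumes "subtraction_closed V" "Modules.module s" "x \<in> V"
  shows "s (of_nat k) x \<in> V"
proof -
  interpret Modules.module s by fact
  show ?thesis
    by (induction k) (simp_all add: scale_left_distrib assms subtraction_closed_add
        subtraction_closed_zero[OF assms(1,3)])
qed

lemma scale_of_nat_cong:
  assumes "Modules.module s" and tors: "\<And>v. s (of_nat p) v = 0" and "[k = l] (mod p)"
  shows "s (of_nat k) w = s (of_nat l) w"
proof -
  interpret Modules.module s by fact
  have "s (of_nat k) w = s (of_nat (k mod p)) w" for k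
  proof -
    have "s (of_nat (k mod p + p * (k div p))) w = s (of_nat (k mod p)) w + s (of_nat p) (s (of_nat (k div p)) w)"
      by (simp only: of_nat_add of_nat_mult scale_left_distrib scale_scale)
    then show ?thesis unfolding tors by simp
  qed
  then show ?thesis using assms(3) by (metis unique_euclidean_semiring_class.cong_def)
qed

text \<open>The eigenvectors are obtained by applying to v the indicator polynomials of the residues c:
  \<open>1 - x\<^sup>p\<^sup>-\<^sup>1\<close> for c = 0, and otherwise \<open>1 - (x - c)\<^sup>p\<^sup>-\<^sup>1\<close> modulo \<open>p\<close> and \<open>x\<^sup>p - x\<close>.\<close>

lemma eigenvector_decomposition:
  fixes s :: "'c::comm_ring_1 \<Rightarrow> 'v::ab_group_add \<Rightarrow> 'v"
  assumes p: "Factorial_Ring.prime (p::nat)" and mod: "Modules.module s"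
    and tors: "\<And>v. s (of_nat p) v = 0"
    and T: "Modules.additive T" and Tp: "(T ^^ p) v = T v"
    and V: "subtraction_closed V" "\<And>w. w \<in> V \<Longrightarrow> T w \<in> V" "v \<in> V"
  shows "\<exists>e. v = (\<Sum>c<p. e c) \<and> (\<forall>c<p. e c \<in> V \<and> T (e c) = s (of_nat c) (e c))"
proof -
  interpret Modules.module s by fact
  interpret T: Modules.additive T by fact
  have p2: "p \<ge> 2" using p prime_ge_2_nat by blast
  have dvd0: "s (of_nat k) w = 0" if "p dvd k" for k w
    using scale_of_nat_cong[OF mod tors, of k 0 w] that by (simp add: cong_0_iff)
  note mod_eq = scale_of_nat_cong[OF mod tors]
  \<comment> \<open>For c \<noteq> 0 the constant term 1 - c^(p-1) vanishes modulo p, so the sum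
    starts at j = 1; modulo p the binomial coefficients of (x - c)^(p-1) cancel its signs.\<close>
  define e where "e c = (if c = 0 then v - (T ^^ (p - 1)) v
    else - (\<Sum>j=1..p-1. s (of_nat (c ^ (p - 1 - j))) ((T ^^ j) v)))" for c
  have V0: "0 \<in> V" using subtraction_closed_zero V by blast
  have TV: "(T ^^ j) v \<in> V" for j by (induction j) (auto intro: V)
  have "s (of_nat k) ((T ^^ j) v) \<in> V" for j k
    by (rule subtraction_closed_scale_of_nat[OF V(1) mod TV])
  then have "(\<Sum>j=1..p-1. s (of_nat (c ^ (p - 1 - j))) ((T ^^ j) v)) \<in> V" for c
    by (intro subtraction_closed_sum V(1) V0)
  then have eV: "e c \<in> V" for c
    unfolding e_def by (simp add: subtraction_closedD[OF V(1) V(3) TV]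
        subtraction_closed_minus[OF V(1)])
  have Te: "T (e c) = s (of_nat c) (e c)" if c: "c < p" for c
  proof (cases "c = 0")
    case True
    have "T ((T ^^ (p - 1)) v) = (T ^^ p) v"
      using p2 by (cases p) auto
    then show ?thesis using True Tp by (simp add: e_def T.diff)
  next
    case False
    \<comment> \<open>\<open>T\<close> shifts the index of \<open>f\<close> by one, so only the two
      end terms matter; both are \<open>T v\<close>, by Fermat and by the hypothesis on
      \<open>v\<close>.\<close>
    define f where "f j = s (of_nat (c ^ (p - j))) ((T ^^ j) v)" for j
    have "[c ^ (p - 1) = 1] (mod p)"
      using False c p by (intro fermat_theorem) (auto dest: dvd_imp_le)
    then have f1: "f 1 = T v" unfolding f_def using mod_eq[of "c ^ (p-1)" 1] by simp
    have fp: "f p = T v" using Tp by (simp add: f_def)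
    have "(\<Sum>j=1..p-1. f (Suc j) - f j) = f (Suc (p - 1)) - f 1"
      by (rule sum_Suc_diff) simp
    then have "(\<Sum>j=1..p-1. f (Suc j)) = (\<Sum>j=1..p-1. f j)"
      using f1 fp p2 by (simp add: sum_subtractf)
    moreover have "T (e c) = - (\<Sum>j=1..p-1. f (Suc j))"
      using False by (simp add: e_def f_def T.minus T.sum T.scale_of_nat[OF mod mod] del: of_nat_power)
    moreover have "s (of_nat c) (e c) = - (\<Sum>j=1..p-1. f j)"
    proof -
      have "c * c ^ (p - 1 - j) = c ^ (p - j)" if "j \<in> {1..p-1}" for j
      proof -
        have "p - j = Suc (p - 1 - j)" using that by auto
        then show ?thesis by simp
      qed
      then show ?thesis using False
        by (auto simp add: e_def f_def scale_sum_right simp flip: of_nat_mult intro!: sum.cong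
            simp del: of_nat_power)
    qed
    ultimately show ?thesis by simp
  qed
  have "(\<Sum>c=1..<p. e c) = - (\<Sum>c=1..<p. \<Sum>j=1..p-1. s (of_nat (c ^ (p - 1 - j))) ((T ^^ j) v))"
    by (simp add: e_def sum_negf)
  also have "\<dots> = - (\<Sum>j=1..p-1. s (of_nat (\<Sum>c=1..<p. c ^ (p - 1 - j))) ((T ^^ j) v))"
    by (subst sum.swap) (simp add: scale_sum_left)
  \<comment> \<open>The coefficients are power sums over the nonzero residues: -1 for exponent 0,
    and 0 modulo p for exponents strictly between 0 and p - 1.\<close>
  also have "\<dots> = - (\<Sum>j=1..p-1. if j = p - 1 then - ((T ^^ j) v) else 0)"
  proof -
    have "s (of_nat (\<Sum>c=1..<p. c ^ (p - 1 - j))) w = (if j = p - 1 then - w else 0)"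
      if j: "j \<in> {1..p-1}" for j w
    proof (cases "j = p - 1")
      case True
      have "s (of_nat p) w = s (of_nat (p - 1)) w + w"
        using p2 scale_left_distrib[of "of_nat (p - 1)" 1 w] by (simp add: of_nat_diff)
      then show ?thesis using True tors[of w] by (simp add: eq_neg_iff_add_eq_0)
    next
      case False
      define k where "k = p - 1 - j"
      have k: "0 < k" "k < p - 1" using j False by (auto simp: k_def)
      have "int p dvd (\<Sum>c<p. int c ^ k)" using prime_dvd_sum_of_powers[OF p k(2)] .
      also have "(\<Sum>c<p. int c ^ k) = int (\<Sum>c<p. c ^ k)" by simp
      finally have "p dvd (\<Sum>c<p. c ^ k)" by (simp only: int_dvd_int_iff)
      moreover have "(\<Sum>c<p. c ^ k) = (\<Sum>c=1..<p. c ^ k)"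
        using k p2 by (intro sum.mono_neutral_right) (auto simp: Suc_le_eq)
      ultimately show ?thesis using dvd0 False by (simp add: k_def del: of_nat_sum of_nat_power)
    qed
    then show ?thesis by (intro arg_cong[where f=uminus] sum.cong HOL.refl) auto
  qed
  also have "\<dots> = (T ^^ (p - 1)) v" using p2 by (auto simp: sum.delta)
  finally have "(\<Sum>c=1..<p. e c) = (T ^^ (p - 1)) v" .
  moreover have "(\<Sum>c<p. e c) = e 0 + (\<Sum>c=1..<p. e c)"
    using p2 by (simp add: lessThan_atLeast0 sum.atLeast_Suc_lessThan)
  ultimately have "v = (\<Sum>c<p. e c)" by (simp add: e_def)
  then show ?thesis using eV Te by blast
qed

section \<open>Lifting horizontal sections\<close>

text \<open>One family \<open>E\<close>, of the top level, stands for the structures of all levels: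
  a lower level is seen only through the operators of index p^c, which level reduction does not
  change. \<open>p_torsion\<close> is the form in which flatness over Z/p^(m+1) enters.\<close>

locale dormant_tower =
  fixes p m :: nat
    and s :: "'a::comm_ring_1 fps \<Rightarrow> 'm::ab_group_add \<Rightarrow> 'm"
    and \<delta> :: "'m \<Rightarrow> 'm"
    and s\<^sub>0 :: "'r::comm_ring_1 fps \<Rightarrow> 'v::ab_group_add \<Rightarrow> 'v"
    and r :: "'m \<Rightarrow> 'v"
    and E :: "nat \<Rightarrow> 'v \<Rightarrow> 'v"
  assumes prime_p: "Factorial_Ring.prime p"
    and module_s: "Modules.module s" and module_s0: "Modules.module s\<^sub>0"
    and additive_\<delta>: "Modules.additive \<delta>" and additive_r: "Modules.additive r"
    and surj_r: "surj r"
    and r_eq_0_iff: "r x = 0 \<longleftrightarrow> (\<exists>y. x = s (of_nat p) y)"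
    and p_torsion: "s (of_nat p) x = 0 \<Longrightarrow> \<exists>y. x = s (of_nat (p ^ m)) y"
    and additive_E: "Modules.additive (E j)"
    and E_commute: "E i (E j v) = E j (E i v)"
    and E_r: "E (p ^ 0) (r x) = r (\<delta> x)"
    and E_power_p: "b \<le> m \<Longrightarrow> \<forall>c<b. E (p ^ c) v = 0 \<Longrightarrow> (E (p ^ b) ^^ p) v = E (p ^ b) v"
    and E_eq_delta_hor: "1 \<le> b \<Longrightarrow> b \<le> m \<Longrightarrow> \<forall>c<b. E (p ^ c) v = 0 \<Longrightarrow>
      E (p ^ b) v = delta_hor p s \<delta> r b E v"
begin

sublocale s: Modules.module s by (rule module_s)
sublocale s0: Modules.module s\<^sub>0 by (rule module_s0)
sublocale \<delta>: Modules.additive \<delta> by (rule additive_\<delta>)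
sublocale r: Modules.additive r by (rule additive_r)
sublocale E: Modules.additive "E j" for j by (rule additive_E)

definition pm :: "nat \<Rightarrow> 'm \<Rightarrow> 'm" where "pm a x = s (of_nat (p ^ a)) x"

lemma pm_0 [simp]: "pm 0 x = x" by (simp add: pm_def)
lemma pm_zero [simp]: "pm a 0 = 0" by (simp add: pm_def)
lemma pm_pm: "pm a (pm b x) = pm (a + b) x" by (simp add: pm_def power_add)
lemma pm_add: "pm a (x + y) = pm a x + pm a y" by (simp add: pm_def s.scale_right_distrib)
lemma pm_diff: "pm a (x - y) = pm a x - pm a y" by (simp add: pm_def s.scale_right_diff_distrib)
lemma pm_of_nat: "s (of_nat k) (pm a x) = pm a (s (of_nat k) x)"
  by (simp add: pm_def mult.commute)
lemma \<delta>_of_nat: "\<delta> (s (of_nat k) x) = s (of_nat k) (\<delta> x)"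
  by (rule \<delta>.scale_of_nat[OF module_s module_s])
lemma r_of_nat: "r (s (of_nat k) x) = s\<^sub>0 (of_nat k) (r x)"
  by (rule r.scale_of_nat[OF module_s module_s0])
lemma \<delta>_pm: "\<delta> (pm a x) = pm a (\<delta> x)"
  unfolding pm_def by (rule \<delta>_of_nat)
lemma pm_1: "pm 1 x = s (of_nat p) x" by (simp add: pm_def)
lemma r_pm_Suc [simp]: "r (pm (Suc a) x) = 0"
proof -
  have "pm (Suc a) x = s (of_nat p) (pm a x)" by (simp add: pm_def)
  then show ?thesis unfolding r_eq_0_iff by blast
qed
lemma r_eq_0_iff_pm: "r x = 0 \<longleftrightarrow> (\<exists>y. x = pm 1 y)"
  unfolding pm_1 by (rule r_eq_0_iff)
lemma char_p: "s\<^sub>0 (of_nat p) v = 0"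
proof -
  obtain x where "v = r x" using surj_r by (metis surjD)
  then show ?thesis using r_of_nat[of p x] r_eq_0_iff[of "s (of_nat p) x"] by auto
qed

lemma pm_1_torsion: "pm 1 x = 0 \<Longrightarrow> \<exists>y. x = pm m y"
  using p_torsion[of x] by (simp add: pm_def)

text \<open>The horizontal sections of level b - 1 (all sections for b = 0): the operators of index
  p^c with c < b already detect them.\<close>

definition W :: "nat \<Rightarrow> 'v set" where "W b = {v. \<forall>c<b. E (p ^ c) v = 0}"

lemma W_0 [simp]: "W 0 = UNIV" by (simp add: W_def)
lemma W_Suc: "W (Suc b) = {v \<in> W b. E (p ^ b) v = 0}"
  by (auto simp: W_def less_Suc_eq)
lemma W_closed: "subtraction_closed (W b)"
  by (simp add: W_def subtraction_closed_def E.diff)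
lemma E_funpow_commute: "E i ((E j ^^ n) v) = (E j ^^ n) (E i v)"
  by (induction n) (simp_all add: E_commute[of i])
lemma E_funpow_zero [simp]: "(E j ^^ n) 0 = 0"
  by (induction n) (simp_all add: E.zero)
lemma E_W: "v \<in> W b \<Longrightarrow> E j v \<in> W b"
  by (simp add: W_def E_commute[of _ j] E.zero)
lemma E_funpow_W: "v \<in> W b \<Longrightarrow> (E j ^^ n) v \<in> W b"
  by (simp add: W_def E_funpow_commute)
lemma E_power_W: "b \<le> m \<Longrightarrow> v \<in> W b \<Longrightarrow> (E (p ^ b) ^^ p) v = E (p ^ b) v"
  using E_power_p by (simp add: W_def)

lemma p_ge_2: "p \<ge> 2" using prime_p prime_ge_2_nat by blast

lemma funpow_p: "(f ^^ p) v = f ((f ^^ (p - 1)) v)" "(f ^^ (p - 1)) v = f ((f ^^ (p - 2)) v)"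
proof -
  obtain q where "p = Suc (Suc q)" using p_ge_2 by (metis add_2_eq_Suc le_Suc_ex)
  then show "(f ^^ p) v = f ((f ^^ (p - 1)) v)" "(f ^^ (p - 1)) v = f ((f ^^ (p - 2)) v)" by simp_all
qed

lemma additive_cartier: "Modules.additive (cartier p E b)"
proof (induction b)
  case 0
  then show ?case by unfold_locales simp
next
  case (Suc b)
  interpret c: Modules.additive "cartier p E b" by fact
  interpret f: Modules.additive "E (p ^ b) ^^ (p - 1)" by (rule additive_funpow[OF additive_E])
  show ?case using f.add by unfold_locales (simp add: c.add)
qed

sublocale cartier: Modules.additive "cartier p E b" for b by (rule additive_cartier)

text \<open>On \<open>W b\<close> the operator T = \<open>E (p ^ b)\<close> satisfies T^p = T, so 1
  - T^(p-1) projects onto its kernel, and that kernel inside \<open>W b\<close> is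
  \<open>W (Suc b)\<close>.\<close>

lemma cartier_W: "b \<le> Suc m \<Longrightarrow> cartier p E b v \<in> W b"
proof (induction b)
  case (Suc b)
  define w where "w = cartier p E b v"
  have w: "w \<in> W b" using Suc w_def by simp
  have "E (p ^ b) (w - (E (p ^ b) ^^ (p - 1)) w) = E (p ^ b) w - (E (p ^ b) ^^ p) w"
    by (simp only: E.diff funpow_p(1))
  also have "\<dots> = 0" using E_power_W[OF _ w] Suc.prems by simp
  finally have *: "E (p ^ b) (w - (E (p ^ b) ^^ (p - 1)) w) = 0" .
  have "w - (E (p ^ b) ^^ (p - 1)) w \<in> W b"
    using w E_funpow_W W_closed subtraction_closedD by blast
  then show ?case using * by (simp add: W_Suc w_def)
qed simp

lemma cartier_on_W: "v \<in> W b \<Longrightarrow> cartier p E b v = v"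
proof (induction b)
  case (Suc b)
  then have "v \<in> W b" "E (p ^ b) v = 0" by (auto simp: W_Suc)
  then have "(E (p ^ b) ^^ (p - 1)) v = 0" by (simp only: funpow_p(2) E_funpow_commute E_funpow_zero)
  then show ?case using Suc.IH \<open>v \<in> W b\<close> by simp
qed simp

text \<open>The point is that \<open>\<delta>\<^sub>V\<close> does not depend on the choice of the lift.\<close>

lemma E_lift:
  assumes "b \<le> m" "\<delta> x = pm b y"
  shows "r x \<in> W b \<and> E (p ^ b) (r x) = cartier p E b (r y)"
  using assms
proof (induction b arbitrary: x y)
  case 0
  then show ?case using E_r[of x] by simp
next
  case (Suc b)
  \<comment> \<open>Reading p^(b+1) y as p^b (p y) makes the induction hypothesis give
    \<open>E (p ^ b) (r x) = 0\<close>, since \<open>r\<close> kills p y.\<close>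
  have "r x \<in> W b \<and> E (p ^ b) (r x) = cartier p E b (r (pm 1 y))"
    using Suc by (intro Suc.IH) (simp_all add: pm_pm)
  then have W: "r x \<in> W (Suc b)" by (simp add: W_Suc cartier.zero)
  have pair: "lift_pair p s \<delta> r (Suc b) (r x) (x, y)"
    unfolding lift_pair_def using Suc.prems(2) by (auto simp: pm_def intro!: exI[of _ 0])
  define xy where "xy = (SOME xy. lift_pair p s \<delta> r (Suc b) (r x) xy)"
  obtain x' y' where xy': "xy = (x', y')" by fastforce
  have "lift_pair p s \<delta> r (Suc b) (r x) xy" 
    unfolding xy_def using someI[of "lift_pair p s \<delta> r (Suc b) (r x)", OF pair] by simp
  then obtain z where x': "r x' = r x" and "\<delta> x' = s (of_nat (p ^ Suc b)) y' + s (of_nat (p ^ (Suc b + 1))) z"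
    unfolding lift_pair_def xy' by blast
  then have dx': "\<delta> x' = pm (Suc b) y' + pm (Suc (Suc b)) z" by (simp add: pm_def)
  \<comment> \<open>The given lift and the one selected by \<open>SOME\<close> differ by some p u;
    the discrepancy between \<open>y\<close> and \<open>y'\<close> is then governed by \<delta> u,
    one level down.\<close>
  have "r (x - x') = 0" using x' by (simp add: r.diff)
  then obtain u where u: "x - x' = pm 1 u" using r_eq_0_iff_pm by blast
  have "pm 1 (\<delta> u) = \<delta> x - \<delta> x'" by (simp only: \<delta>_pm[symmetric] u[symmetric] \<delta>.diff)
  also have "\<dots> = pm 1 (pm b (y - y' - pm 1 z))"
    unfolding Suc.prems(2) dx' by (simp add: pm_pm pm_diff pm_add algebra_simps)
  finally have "pm 1 (\<delta> u - pm b (y - y' - pm 1 z)) = 0" by (simp add: pm_diff)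
  then obtain w where w: "\<delta> u - pm b (y - y' - pm 1 z) = pm m w" using pm_1_torsion by blast
  \<comment> \<open>As b < m, the error p^m w is p^b times a multiple of p and disappears under
    \<open>r\<close>.\<close>
  obtain k where k: "m = Suc k + b" using Suc.prems(1) by (metis add.commute add_Suc le_Suc_ex add_Suc_shift)
  have "\<delta> u = pm b (y - y' - pm 1 z + pm (Suc k) w)"
    using w unfolding pm_add pm_pm k by (simp add: algebra_simps add.commute)
  moreover have "r (y - y' - pm 1 z + pm (Suc k) w) = r y - r y'"
    by (simp add: r.add r.diff)
  ultimately have ru: "r u \<in> W b" "E (p ^ b) (r u) = cartier p E b (r y - r y')"
    using Suc.IH[of u] Suc.prems(1) by auto
  \<comment> \<open>With T = \<open>E (p ^ b)\<close>, the power T^(p-1) fixes the image of T on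
    \<open>W b\<close>, so the next Cartier factor kills the discrepancy
    \<open>E (p ^ b) (r u)\<close>.\<close>
  have "cartier p E (Suc b) (r y - r y') = E (p ^ b) (r u) - (E (p ^ b) ^^ (p - 1)) (E (p ^ b) (r u))"
    by (simp add: ru)
  also have "(E (p ^ b) ^^ (p - 1)) (E (p ^ b) (r u)) = E (p ^ b) (r u)"
    using E_power_W[OF _ ru(1)] Suc.prems(1) by (simp add: funpow_p(1) E_funpow_commute del: funpow.simps)
  finally have "cartier p E (Suc b) (r y) = cartier p E (Suc b) (r y')"
    by (simp only: cartier.diff diff_self right_minus_eq)
  moreover have "E (p ^ Suc b) (r x) = delta_hor p s \<delta> r (Suc b) E (r x)"
    using W Suc.prems(1) by (intro E_eq_delta_hor) (auto simp: W_def)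
  then have "E (p ^ Suc b) (r x) = cartier p E (Suc b) (r y')"
    unfolding delta_hor_def xy_def[symmetric] xy' snd_conv .
  ultimately show ?case using W by simp
qed

end

locale dormant_sublattice = dormant_tower +
  fixes L
  assumes L_closed: "subtraction_closed L" and L_zero: "0 \<in> L"
    and \<delta>_L: "x \<in> L \<Longrightarrow> \<delta> x \<in> L"
    and L_saturated: "x \<in> L \<Longrightarrow> r x = 0 \<Longrightarrow> \<exists>y\<in>L. x = s (of_nat p) y"
    and E_L: "v \<in> r ` L \<Longrightarrow> E j v \<in> r ` L"
begin

lemma rL_closed: "subtraction_closed (r ` L)"
  using L_closed by (auto simp: subtraction_closed_def simp flip: r.diff)

lemma L_of_nat: "x \<in> L \<Longrightarrow> s (of_nat k) x \<in> L"
  by (rule subtraction_closed_scale_of_nat[OF L_closed module_s])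
lemma L_pm: "x \<in> L \<Longrightarrow> pm k x \<in> L"
  unfolding pm_def by (rule L_of_nat)
lemma L_add: "x \<in> L \<Longrightarrow> y \<in> L \<Longrightarrow> x + y \<in> L"
  by (rule subtraction_closed_add[OF L_closed])
lemma L_diff: "x \<in> L \<Longrightarrow> y \<in> L \<Longrightarrow> x - y \<in> L"
  by (rule subtraction_closedD[OF L_closed])
lemma E_funpow_L: "v \<in> r ` L \<Longrightarrow> (E j ^^ n) v \<in> r ` L"
  by (induction n) (auto intro: E_L)

lemma cartier_L: "v \<in> r ` L \<Longrightarrow> cartier p E b v \<in> r ` L"
  by (induction b) (auto intro!: subtraction_closedD[OF rL_closed] E_funpow_L)

text \<open>The two claims feed each other. A lift to level b of a section of
  \<open>W (Suc b)\<close> has an error in the Cartier kernel, which the second claim absorbs. In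
  turn, an element of the next Cartier kernel has as its Cartier image \<open>E (p ^ b)\<close> of a
  section that lifts by the first claim.\<close>

lemma lifts:
  assumes "b \<le> m"
  shows "(\<forall>v \<in> W b \<inter> r ` L. \<exists>x\<in>L. \<exists>y\<in>L. r x = v \<and> \<delta> x = pm b y) \<and>
    (\<forall>y\<in>L. cartier p E b (r y) = 0 \<longrightarrow>
      (\<exists>u\<in>L. \<exists>y'\<in>L. pm b y = \<delta> (pm 1 u) + pm (Suc b) y'))"
  using assms
proof (induction b)
  case 0
  have "\<exists>u\<in>L. \<exists>y'\<in>L. y = \<delta> (pm 1 u) + pm (Suc 0) y'" if y: "y \<in> L" "r y = 0" for y
  proof -
    obtain y' where "y' \<in> L" "y = pm 1 y'" using L_saturated y unfolding pm_1 by blast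
    then show ?thesis using L_zero by (intro bexI[of _ 0] bexI[of _ y']) (simp_all add: \<delta>.zero)
  qed
  then show ?case using \<delta>_L by auto
next
  case (Suc b)
  then have b: "b \<le> m" and IH1: "\<And>v. v \<in> W b \<Longrightarrow> v \<in> r ` L \<Longrightarrow> \<exists>x\<in>L. \<exists>y\<in>L. r x = v \<and> \<delta> x = pm b y"
    and IH2: "\<And>y. y \<in> L \<Longrightarrow> cartier p E b (r y) = 0 \<Longrightarrow>
      \<exists>u\<in>L. \<exists>y'\<in>L. pm b y = \<delta> (pm 1 u) + pm (Suc b) y'"
    by auto
  have "\<exists>x\<in>L. \<exists>y\<in>L. r x = v \<and> \<delta> x = pm (Suc b) y" if v: "v \<in> W (Suc b)" "v \<in> r ` L" for v
  proof -
    obtain x y where x: "x \<in> L" "y \<in> L" "r x = v" "\<delta> x = pm b y"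
      using IH1[of v] v by (auto simp: W_Suc)
    \<comment> \<open>By \<open>E_lift\<close> the vanishing of \<open>E (p ^ b) v\<close> is the
      vanishing of the Cartier image of the error.\<close>
    have "cartier p E b (r y) = 0" using E_lift[OF b x(4)] v x by (simp add: W_Suc)
    then obtain u y' where u: "u \<in> L" "y' \<in> L" "pm b y = \<delta> (pm 1 u) + pm (Suc b) y'"
      using IH2 x by blast
    show ?thesis
    proof (intro bexI conjI)
      show "r (x - pm 1 u) = v" using x by (simp add: r.diff)
      show "\<delta> (x - pm 1 u) = pm (Suc b) y'" using x u by (simp add: \<delta>.diff)
    qed (use x u in \<open>auto intro: L_diff L_pm\<close>)
  qed
  moreover have "\<exists>u\<in>L. \<exists>y'\<in>L. pm (Suc b) y = \<delta> (pm 1 u) + pm (Suc (Suc b)) y'"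
    if y: "y \<in> L" "cartier p E (Suc b) (r y) = 0" for y
  proof -
    define w where "w = cartier p E b (r y)"
    have w: "w \<in> W b" "w \<in> r ` L" using cartier_W b cartier_L y w_def by auto
    \<comment> \<open>In the kernel of 1 - T^(p-1) one has w = T(T^(p-2) w), which exhibits w as an
      image under T = \<open>E (p ^ b)\<close>.\<close>
    have "w = E (p ^ b) ((E (p ^ b) ^^ (p - 2)) w)" using y(2) funpow_p(2)[of "E (p ^ b)" w]
      by (simp add: w_def)
    moreover obtain x1 y1 where x1: "x1 \<in> L" "y1 \<in> L" "r x1 = (E (p ^ b) ^^ (p - 2)) w" "\<delta> x1 = pm b y1"
      using IH1[OF E_funpow_W[OF w(1)] E_funpow_L[OF w(2)]] by blast
    ultimately have "cartier p E b (r (y - y1)) = 0"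
      using E_lift[OF b x1(4)] by (simp add: r.diff cartier.diff w_def)
    then obtain u y' where u: "u \<in> L" "y' \<in> L" "pm b (y - y1) = \<delta> (pm 1 u) + pm (Suc b) y'"
      using IH2[of "y - y1"] y x1 L_diff by blast
    have "pm b y = \<delta> (x1 + pm 1 u) + pm (Suc b) y'"
      using u(3) x1(4) by (simp add: pm_diff \<delta>.add algebra_simps)
    \<comment> \<open>Multiplying by p turns \<open>x1\<close> into a change of the lift by a
      multiple of p, as the claim demands, and raises the level by one.\<close>
    then have "pm 1 (pm b y) = \<delta> (pm 1 (x1 + pm 1 u)) + pm 1 (pm (Suc b) y')"
      using \<delta>_pm[of 1 "x1 + pm 1 u"] pm_add[of 1] by simp
    then show ?thesis
      using u x1 by (intro bexI[of _ "x1 + pm 1 u"] bexI[of _ y'])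
        (auto simp: pm_pm intro: L_add L_pm)
  qed
  ultimately show ?case by blast
qed

lemma eigenvector_lifts:
  assumes a: "a \<le> m" and x: "x \<in> L" "\<delta> x = pm a y"
  shows "\<exists>f. \<exists>z\<in>L. x = (\<Sum>c<p. f c) + pm 1 z \<and>
    (\<forall>c<p. f c \<in> L \<and> (\<exists>w\<in>L. \<delta> (f c) = s (of_nat (c * p ^ a)) (f c) + pm (Suc a) w))"
proof -
  define v where "v = r x"
  have v: "v \<in> W a \<inter> r ` L" using E_lift[OF a x(2)] x(1) v_def by auto
  have cl: "subtraction_closed (W a \<inter> r ` L)"
    using W_closed rL_closed unfolding subtraction_closed_def by blast
  have "\<exists>e. v = (\<Sum>c<p. e c) \<and> (\<forall>c<p. e c \<in> W a \<inter> r ` L \<and> E (p ^ a) (e c) = s\<^sub>0 (of_nat c) (e c))"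
    using v by (intro eigenvector_decomposition[OF prime_p module_s0 char_p additive_E _ cl])
      (auto intro: E_power_W[OF a] E_W E_L)
  then obtain e where e: "v = (\<Sum>c<p. e c)" "\<And>c. c < p \<Longrightarrow> e c \<in> W a \<inter> r ` L"
    "\<And>c. c < p \<Longrightarrow> E (p ^ a) (e c) = s\<^sub>0 (of_nat c) (e c)" by blast
  have "\<exists>g\<in>L. r g = e c \<and> (\<exists>w\<in>L. \<delta> g = s (of_nat (c * p ^ a)) g + pm (Suc a) w)"
    if c: "c < p" for c
  proof -
    obtain g y where g: "g \<in> L" "y \<in> L" "r g = e c" "\<delta> g = pm a y"
      using lifts[OF a] e(2)[OF c] by blast
    \<comment> \<open>As \<open>e c\<close> lies in \<open>W a\<close>, the Cartier composite fixes
      it; hence y and c g have the same Cartier image, and their difference can be absorbed.\<close>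
    have "cartier p E a (r (y - s (of_nat c) g)) = cartier p E a (r y) - s\<^sub>0 (of_nat c) (e c)"
    proof -
      have "cartier p E a (s\<^sub>0 (of_nat c) (e c)) = s\<^sub>0 (of_nat c) (e c)"
        using e(2)[OF c] by (simp add: cartier.scale_of_nat[OF module_s0 module_s0] cartier_on_W)
      then show ?thesis by (simp add: r.diff cartier.diff r_of_nat g)
    qed
    also have "\<dots> = 0" using E_lift[OF a g(4)] g e(3)[OF c] by simp
    finally obtain u y' where u: "u \<in> L" "y' \<in> L" "pm a (y - s (of_nat c) g) = \<delta> (pm 1 u) + pm (Suc a) y'"
      using lifts[OF a] L_diff[OF g(2) L_of_nat[OF g(1)]] by blast
    have sc: "s (of_nat (c * p ^ a)) h = pm a (s (of_nat c) h)" for h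
      by (simp add: pm_def mult.commute)
    have "\<delta> (g - pm 1 u) = pm a (s (of_nat c) g) + pm (Suc a) y'"
      using u(3) g(4) by (simp add: \<delta>.diff pm_diff algebra_simps)
    \<comment> \<open>Passing from \<open>g\<close> to \<open>g - pm 1 u\<close> in the eigenvalue
      term costs c p^(a+1) u, which joins the remainder.\<close>
    also have "\<dots> = pm a (s (of_nat c) (g - pm 1 u)) + pm (Suc a) (y' + s (of_nat c) u)"
      by (simp add: s.scale_right_diff_distrib pm_diff pm_add pm_of_nat pm_pm)
    finally show ?thesis unfolding sc
      using g u by (intro bexI[of _ "g - pm 1 u"] conjI bexI[of _ "y' + s (of_nat c) u"])
        (auto intro: L_diff L_pm L_add L_of_nat simp: r.diff)
  qed
  then obtain f where f: "\<And>c. c < p \<Longrightarrow> f c \<in> L" "\<And>c. c < p \<Longrightarrow> r (f c) = e c"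
    "\<And>c. c < p \<Longrightarrow> \<exists>w\<in>L. \<delta> (f c) = s (of_nat (c * p ^ a)) (f c) + pm (Suc a) w"
    by metis
  have "(\<Sum>c<p. f c) \<in> L"
    using f by (intro subtraction_closed_sum L_closed L_zero) auto
  moreover have "r (x - (\<Sum>c<p. f c)) = 0"
    using e(1) f(2) by (simp add: r.diff r.sum v_def)
  ultimately obtain z where "z \<in> L" "x - (\<Sum>c<p. f c) = pm 1 z"
    using L_saturated[of "x - (\<Sum>c<p. f c)"] L_diff x(1) unfolding pm_1 by blast
  then have "x = (\<Sum>c<p. f c) + pm 1 z" by (simp add: algebra_simps)
  then show ?thesis using \<open>z \<in> L\<close> f by blast
qed

end

section \<open>Logarithmic differential operators\<close>

text \<open>From i C(p^b, i) = p^b C(p^b - 1, i - 1): a binomial coefficient prime to p would force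
  p^b to divide i.\<close>

lemma prime_dvd_choose_prime_power:
  assumes p: "Factorial_Ring.prime (p::nat)" and i: "0 < i" "i < p ^ b"
  shows "p dvd (p ^ b choose i)"
proof (rule ccontr)
  assume "\<not> p dvd (p ^ b choose i)"
  then have "coprime (p ^ b) (p ^ b choose i)"
    using p by (simp add: prime_imp_coprime)
  moreover have "p ^ b dvd i * (p ^ b choose i)"
    using times_binomial_minus1_eq[of i "p ^ b"] i by simp
  ultimately have "p ^ b dvd i" by (simp add: coprime_dvd_mult_left_iff)
  then show False using i by (auto dest: dvd_imp_le)
qed

text \<open>A case of Lucas' theorem: in Vandermonde's sum for adding p^b only the term i = 0
  survives modulo p.\<close>

lemma choose_add_prime_power_cong:
  assumes p: "Factorial_Ring.prime (p::nat)" and j: "j < p ^ b"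
  shows "[(p ^ b * k + n) choose j = n choose j] (mod p)"
proof (induction k)
  case (Suc k)
  define n' where "n' = p ^ b * k + n"
  have "(p ^ b + n' choose j) = (\<Sum>i\<le>j. (p ^ b choose i) * (n' choose (j - i)))"
    by (rule vandermonde[symmetric])
  also have "\<dots> = (n' choose j) + (\<Sum>i=1..j. (p ^ b choose i) * (n' choose (j - i)))"
    by (simp add: atMost_atLeast0 sum.atLeast_Suc_atMost)
  also have "[\<dots> = (n' choose j) + 0] (mod p)"
    using prime_dvd_choose_prime_power[OF p] j
    by (intro cong_add cong_refl) (auto simp: cong_0_iff intro!: dvd_sum dvd_mult2)
  finally have "[p ^ b + n' choose j = n' choose j] (mod p)" by simp
  also have "[n' choose j = n choose j] (mod p)" unfolding n'_def by (rule Suc.IH)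
  finally show ?case by (simp add: n'_def algebra_simps)
qed simp

lemma not_prime_dvd_choose:
  assumes p: "Factorial_Ring.prime (p::nat)" and l: "l < p ^ b"
  shows "\<not> p dvd (p ^ b * k + l choose l)"
proof -
  have "[p ^ b * k + l choose l = 1] (mod p)"
    using choose_add_prime_power_cong[OF p l, of k l] by simp
  moreover have "\<not> p dvd 1" using p by (simp add: prime_nat_iff)
  ultimately show ?thesis using cong_dvd_iff by blast
qed

lemma scale_of_nat_cancel:
  assumes p: "Factorial_Ring.prime (p::nat)" and mod: "Modules.module s"
    and tors: "\<And>v. s (of_nat p) v = 0" and k: "\<not> p dvd k" and 0: "s (of_nat k) w = 0"
  shows "w = 0"
proof -
  interpret Modules.module s by fact
  have "coprime k p" using prime_imp_coprime[OF p k] by (simp add: coprime_commute)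
  then obtain x where "[k * x = 1] (mod p)" using cong_solve_coprime_nat by auto
  then have "s (of_nat (k * x)) w = s (of_nat 1) w" by (rule scale_of_nat_cong[OF mod tors])
  moreover have "s (of_nat (k * x)) w = s (of_nat x) (s (of_nat k) w)"
    by (simp add: mult.commute)
  ultimately show ?thesis using 0 by simp
qed

lemma of_plocal_of_nat:
  assumes "p > 1"
  shows "of_plocal p (of_nat n) = of_nat n"
proof -
  have "quotient_of (rat_of_nat n) = (int n, 1)"
    using quotient_of_int[of "int n"] by simp
  then show ?thesis using assms by (simp add: of_plocal_def)
qed

lemma D_module_additive: "D_module p a s E \<Longrightarrow> Modules.additive (E j)"
  by (simp add: D_module_def)

text \<open>The composition rule is symmetric in the two indices.\<close>

lemma D_module_commute:
  assumes "D_module p a s E"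
  shows "E i (E j v) = E j (E i v)"
proof -
  have *: "E i (E j v) = (\<Sum>k = max i j..i + j. s (fps_const (of_plocal p
             (fact k / (fact (i + j - k) * fact (k - i) * fact (k - j)) *
              (qfact p a i * qfact p a j / qfact p a k)))) (E k v))" for i j
    using assms by (simp add: D_module_def)
  show ?thesis unfolding *
    by (rule sum.cong) (simp_all add: ac_simps)
qed

text \<open>All terms of \<open>E i (E j v)\<close> except the top one vanish by hypothesis, and the
  top coefficient, being prime to p, can be cancelled.\<close>

lemma D_module_product_zero:
  assumes p: "Factorial_Ring.prime p" and mod: "Modules.module s"
    and tors: "\<And>v. s (of_nat p) v = 0" and D: "D_module p a s E"
    and j: "i \<ge> 1" "j \<ge> 1" and 0: "\<And>k. 1 \<le> k \<Longrightarrow> k < i + j \<Longrightarrow> E k v = 0"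
    and c: "fact (i + j) / (fact j * fact i) *
      (qfact p a i * qfact p a j / qfact p a (i + j)) = of_nat c" "\<not> p dvd c"
  shows "E (i + j) v = 0"
proof -
  interpret Modules.module s by fact
  interpret E: Modules.additive "E k" for k by (rule D_module_additive[OF D])
  define C where "C k = s (fps_const (of_plocal p
             (fact k / (fact (i + j - k) * fact (k - i) * fact (k - j)) *
              (qfact p a i * qfact p a j / qfact p a k)))) (E k v)" for k
  have "0 = E i (E j v)" using 0 j by (simp add: E.zero)
  also have "\<dots> = (\<Sum>k = max i j..i + j. C k)"
    using D by (simp add: D_module_def C_def)
  also have "\<dots> = (\<Sum>k \<in> {i + j}. C k)"
    using 0 j by (intro sum.mono_neutral_right) (auto simp: C_def)
  also have "\<dots> = s (fps_const (of_plocal p (fact (i + j) / (fact j * fact i) *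
      (qfact p a i * qfact p a j / qfact p a (i + j))))) (E (i + j) v)"
    by (simp add: C_def)
  also have "\<dots> = s (of_nat c) (E (i + j) v)"
    unfolding c(1) using p prime_gt_1_nat by (simp add: of_plocal_of_nat fps_of_nat)
  finally show ?thesis using scale_of_nat_cancel[OF p mod tors c(2)] by simp
qed

text \<open>Induction on j = p^a k + l with l < p^a. Beyond p^a, splitting off l, or p^a when l = 0,
  writes the operator of index j as a product, up to lower terms and a factor prime to p.\<close>

lemma D_module_generators:
  assumes p: "Factorial_Ring.prime p" and mod: "Modules.module s"
    and tors: "\<And>v. s (of_nat p) v = 0" and D: "D_module p a s E"
    and gen: "\<And>l. 1 \<le> l \<Longrightarrow> l < p ^ a \<Longrightarrow> E l v = 0" "E (p ^ a) v = 0"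
    and j: "j \<ge> 1"
  shows "E j v = 0"
  using j
proof (induction j rule: less_induct)
  case (less j)
  define q where "q = p ^ a"
  have q: "q > 0" using p prime_gt_0_nat by (simp add: q_def)
  define k l where "k = j div q" and "l = j mod q"
  have j: "j = q * k + l" "l < q" using q by (auto simp: k_def l_def)
  consider "k = 0" | "k = 1" "l = 0" | "k \<ge> 1" "l \<ge> 1" | "k \<ge> 2" "l = 0" by linarith
  then show ?case
  proof cases
    case 1
    then show ?thesis using j gen less.prems by (simp add: q_def)
  next
    case 2
    then show ?thesis using j gen by (simp add: q_def)
  next
    case 3
    have "E (l + q * k) v = 0"
    proof (rule D_module_product_zero[OF p mod tors D])
      show "l \<ge> 1" "q * k \<ge> 1" using 3 q by auto
      show "E i v = 0" if "1 \<le> i" "i < l + q * k" for i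
        using less.IH[of i] that j by simp
      \<comment> \<open>The level factorials are 0!, k! and k!, so the coefficient is a plain
        binomial one.\<close>
      have "l div q = 0" "q * k div q = k" "(l + q * k) div q = k" using j q by auto
      then show "fact (l + q * k) / (fact (q * k) * fact l) *
         (qfact p a l * qfact p a (q * k) / qfact p a (l + q * k)) = of_nat (q * k + l choose l)"
        by (subst binomial_fact) (simp_all add: qfact_def q_def[symmetric] add.commute mult.commute)
      show "\<not> p dvd (q * k + l choose l)"
        using not_prime_dvd_choose[OF p] j(2) by (simp add: q_def)
    qed
    then show ?thesis using j by (simp add: add.commute)
  next
    case 4
    define k' where "k' = k - 1"
    have k: "k = Suc k'" "k' \<ge> 1" using 4 by (auto simp: k'_def)
    have "E (q + q * k') v = 0"
    proof (rule D_module_product_zero[OF p mod tors D])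
      show "q \<ge> 1" "q * k' \<ge> 1" using k q by auto
      show "E i v = 0" if "1 \<le> i" "i < q + q * k'" for i
        using less.IH[of i] that j k 4 by simp
      have "q div q = 1" "q * k' div q = k'" "(q + q * k') div q = Suc k'" using q by auto
      \<comment> \<open>The level factorials contribute 1 / (k' + 1), which removes the factor k' +
        1 of the binomial coefficient; that factor may be divisible by p.\<close>
      moreover have "q * (q + q * k' choose q) = q * (Suc k' * (q * k' + (q - 1) choose (q - 1)))"
        using times_binomial_minus1_eq[of q "q + q * k'"] q by (simp add: algebra_simps)
      then have "(q + q * k' choose q) = Suc k' * (q * k' + (q - 1) choose (q - 1))"
        using q by simp
      then have "rat_of_nat (q + q * k' choose q) = of_nat (Suc k') * of_nat (q * k' + (q - 1) choose (q - 1))"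
        by (simp only: of_nat_mult)
      then have "fact (q + q * k') / (fact q * fact (q * k')) =
        rat_of_nat (Suc k') * of_nat (q * k' + (q - 1) choose (q - 1))"
        by (subst (asm) binomial_fact) simp_all
      ultimately show "fact (q + q * k') / (fact (q * k') * fact q) *
         (qfact p a q * qfact p a (q * k') / qfact p a (q + q * k')) =
         of_nat (q * k' + (q - 1) choose (q - 1))"
        by (simp add: qfact_def q_def[symmetric] field_simps del: of_nat_Suc)
      show "\<not> p dvd (q * k' + (q - 1) choose (q - 1))"
        using not_prime_dvd_choose[OF p, of "q - 1" a k'] q unfolding q_def[symmetric] by simp
    qed
    then show ?thesis using j k 4 by simp
  qed
qed

lemma cartier_cong:
  assumes "\<And>c. c < b \<Longrightarrow> E (p ^ c) = E' (p ^ c)"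
  shows "cartier p E b v = cartier p E' b v"
  using assms by (induction b) simp_all

text \<open>Replaces the chain of structures hidden in the recursion by the top one. Level reduction
  multiplies the operator of index j < p^(b+1) by the factorial of j div p^b, which is prime to p,
  and equals 1 at j = p^c with c \<le> b.\<close>

lemma diagonal_reductionD:
  fixes s\<^sub>0 :: "'r::comm_ring_1 fps \<Rightarrow> 'v::ab_group_add \<Rightarrow> 'v"
  assumes p: "Factorial_Ring.prime p" and mod: "Modules.module s\<^sub>0"
    and tors: "\<And>v. s\<^sub>0 (of_nat p) v = 0" and red: "diagonal_reduction p s \<delta> s\<^sub>0 r b E"
  shows "D_module p b s\<^sub>0 E \<and> (\<forall>x. E 1 (r x) = r (\<delta> x)) \<and>
    horizontal E = {v. \<forall>c\<le>b. E (p ^ c) v = 0} \<and>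
    (\<forall>c v. c \<le> b \<longrightarrow> (\<forall>i<c. E (p ^ i) v = 0) \<longrightarrow>
      (E (p ^ c) ^^ p) v = E (p ^ c) v \<and>
      (1 \<le> c \<longrightarrow> E (p ^ c) v = delta_hor p s \<delta> r c E v))"
  using red
proof (induction b arbitrary: E)
  case 0
  then have D: "D_module p 0 s\<^sub>0 E" by simp
  have "E j v = 0" if "E 1 v = 0" "j \<ge> 1" for j v
    by (rule D_module_generators[OF p mod tors D _ _ that(2)]) (use that(1) in simp_all)
  then have "horizontal E = {v. E 1 v = 0}"
    unfolding horizontal_def by blast
  then show ?case using 0 by simp
next
  case (Suc b)
  interpret Modules.module s\<^sub>0 by fact
  have p1: "p > 1" using p prime_gt_1_nat by blast
  from Suc.prems obtain E' where E': "diagonal_reduction p s \<delta> s\<^sub>0 r b E'"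
    and D: "D_module p (Suc b) s\<^sub>0 E" and lev: "level_reduction p b s\<^sub>0 E E'"
    and eq: "\<forall>v\<in>horizontal E'. E (p ^ Suc b) v = delta_hor p s \<delta> r (Suc b) E' v"
    and pow: "\<forall>v\<in>horizontal E'.
        (delta_hor p s \<delta> r (Suc b) E' ^^ p) v = delta_hor p s \<delta> r (Suc b) E' v"
    unfolding diagonal_reduction.simps by blast
  interpret E: Modules.additive "E k" for k by (rule D_module_additive[OF D])
  note IH = Suc.IH[OF E']
  from IH have IH_r: "\<forall>x. E' 1 (r x) = r (\<delta> x)"
    and IH_hor: "horizontal E' = {v. \<forall>c\<le>b. E' (p ^ c) v = 0}"
    and IH_pow: "\<And>c v. c \<le> b \<Longrightarrow> \<forall>i<c. E' (p ^ i) v = 0 \<Longrightarrow> (E' (p ^ c) ^^ p) v = E' (p ^ c) v"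
    and IH_delta: "\<And>c v. c \<le> b \<Longrightarrow> \<forall>i<c. E' (p ^ i) v = 0 \<Longrightarrow> 1 \<le> c \<Longrightarrow>
      E' (p ^ c) v = delta_hor p s \<delta> r c E' v"
    by blast+
  have lev': "E' j v = s\<^sub>0 (of_nat (fact (j div p ^ b))) (E j v)" if "j < p ^ Suc b" for j v
  proof -
    have "qfact p b j / qfact p (Suc b) j = of_nat (fact (j div p ^ b))"
      using that by (simp add: qfact_def)
    then show ?thesis using lev p1
      by (simp only: level_reduction_def of_plocal_of_nat fps_of_nat)
  qed
  have E_eq: "E' (p ^ c) = E (p ^ c)" if "c \<le> b" for c
  proof
    fix v
    have "fact (p ^ c div p ^ b) = (1::nat)"
    proof (cases "c = b")
      case False
      then have "p ^ c < p ^ b" using that p1 by (intro power_strict_increasing) auto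
      then show ?thesis by simp
    qed (use p1 in simp)
    moreover have "p ^ c < p ^ Suc b" using that p1 by (intro power_strict_increasing) auto
    ultimately show "E' (p ^ c) v = E (p ^ c) v" using lev' by simp
  qed
  have hor': "horizontal E' = {v. \<forall>c\<le>b. E (p ^ c) v = 0}"
    unfolding IH_hor using E_eq by (intro Collect_cong) simp
  have delta: "delta_hor p s \<delta> r c E' v = delta_hor p s \<delta> r c E v" if "c \<le> Suc b" for c v
    unfolding delta_hor_def by (rule cartier_cong) (use E_eq that in auto)
  have hor: "horizontal E = {v. \<forall>c\<le>Suc b. E (p ^ c) v = 0}"
  proof (intro equalityI subsetI CollectI allI impI)
    fix v c assume "v \<in> horizontal E"
    then show "E (p ^ c) v = 0" using p1 by (simp add: horizontal_def)
  next
    fix v assume v: "v \<in> {v. \<forall>c\<le>Suc b. E (p ^ c) v = 0}"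
    then have h: "v \<in> horizontal E'" by (simp add: hor')
    have "E l v = 0" if l: "1 \<le> l" "l < p ^ Suc b" for l
    proof -
      have "l div p ^ b < p" using l p1 by (simp add: less_mult_imp_div_less)
      then have "\<not> p dvd fact (l div p ^ b)" using p by (simp add: prime_dvd_fact_iff)
      moreover have "s\<^sub>0 (of_nat (fact (l div p ^ b))) (E l v) = 0"
        using h l unfolding lev'[OF l(2), symmetric] by (simp add: horizontal_def)
      ultimately show ?thesis using scale_of_nat_cancel[OF p mod tors] by blast
    qed
    then have "E j v = 0" if "j \<ge> 1" for j
      by (rule D_module_generators[OF p mod tors D _ _ that]) (use v in \<open>simp_all del: power_Suc\<close>)
    then show "v \<in> horizontal E" by (simp add: horizontal_def)
  qed
  have top: "(E (p ^ Suc b) ^^ p) v = E (p ^ Suc b) v \<and> E (p ^ Suc b) v = delta_hor p s \<delta> r (Suc b) E v"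
    if v: "v \<in> horizontal E'" for v
  proof -
    \<comment> \<open>\<open>E (p ^ Suc b)\<close> preserves the horizontal sections of
      \<open>E'\<close> by commutation, so its agreement with \<open>delta_hor\<close> there passes
      to iterates.\<close>
    have "(E (p ^ Suc b) ^^ n) v \<in> horizontal E' \<and>
      (delta_hor p s \<delta> r (Suc b) E' ^^ n) v = (E (p ^ Suc b) ^^ n) v" for n
    proof (induction n)
      case (Suc n)
      define w where "w = (E (p ^ Suc b) ^^ n) v"
      have w: "w \<in> horizontal E'" "(delta_hor p s \<delta> r (Suc b) E' ^^ n) v = w"
        using Suc by (auto simp: w_def)
      have "E (p ^ Suc b) w \<in> horizontal E'"
        unfolding hor'
      proof (intro CollectI allI impI)
        fix c assume "c \<le> b"
        then have "E (p ^ c) w = 0" using w(1) by (simp add: hor')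
        then show "E (p ^ c) (E (p ^ Suc b) w) = 0"
          by (simp only: D_module_commute[OF D, of "p ^ c"] E.zero)
      qed
      then show ?case using eq w by (simp add: w_def[symmetric] del: power_Suc)
    qed (use v in simp)
    from this[of p] show ?thesis
      using pow[rule_format, OF v] eq[rule_format, OF v] delta[OF order.refl, of v] by (simp del: power_Suc)
  qed
  have "(E (p ^ c) ^^ p) v = E (p ^ c) v \<and> (1 \<le> c \<longrightarrow> E (p ^ c) v = delta_hor p s \<delta> r c E v)"
    if "c \<le> Suc b" "\<forall>i<c. E (p ^ i) v = 0" for c v
  proof (cases "c = Suc b")
    case True
    then show ?thesis using that top by (simp add: hor' less_Suc_eq_le del: power_Suc)
  next
    case False
    then have c: "c \<le> b" using that by simp
    then have "\<forall>i<c. E' (p ^ i) v = 0" using that E_eq by simp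
    then show ?thesis using IH_pow[OF c] IH_delta[OF c] delta[of c v] c unfolding E_eq[OF c] by simp
  qed
  moreover have "\<forall>x. E 1 (r x) = r (\<delta> x)" using IH_r E_eq[of 0] by simp
  ultimately show ?case using D hor by blast
qed

section \<open>Flatness over \<open>\<int>/q\<close>\<close>

text \<open>Z/q on the representatives 0, ..., q - 1. The fields for multiplication and one are
  fillers, since a module record extends a ring record.\<close>

definition cyclic_module :: "int \<Rightarrow> (int, int) module" where
  "cyclic_module q = \<lparr>carrier = {0..q - 1}, monoid.mult = (\<lambda>x y. 0), one = 0, zero = 0,
    add = (\<lambda>x y. (x + y) mod q), smult = (\<lambda>b x. (b * x) mod q)\<rparr>"

lemma module_cyclic:
  assumes q: "q > 0" "q dvd Q" "Q > 1"
  shows "Module.module (residue_ring Q) (cyclic_module q)"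
proof (rule Module.moduleI)
  interpret residues Q "residue_ring Q" by unfold_locales (use q in auto)
  show "cring (residue_ring Q)" by (rule cring)
  show "abelian_group (cyclic_module q)"
  proof (rule abelian_groupI)
    fix x assume x: "x \<in> carrier (cyclic_module q)"
    show "\<exists>y\<in>carrier (cyclic_module q). y \<oplus>\<^bsub>cyclic_module q\<^esub> x = \<zero>\<^bsub>cyclic_module q\<^esub>"
      using q by (intro bexI[of _ "(- x) mod q"]) (auto simp: cyclic_module_def mod_simps)
  qed (use q in \<open>auto simp: cyclic_module_def mod_simps ac_simps\<close>)
next
  have mod_Q: "(y mod Q * x) mod q = (y * x) mod q" for x y
    using q by (metis mod_mod_cancel mod_mult_left_eq)
  fix a b x y
  assume "a \<in> carrier (residue_ring Q)" "x \<in> carrier (cyclic_module q)"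
  show "a \<odot>\<^bsub>cyclic_module q\<^esub> x \<in> carrier (cyclic_module q)"
    using q by (simp add: cyclic_module_def)
  show "(a \<oplus>\<^bsub>residue_ring Q\<^esub> b) \<odot>\<^bsub>cyclic_module q\<^esub> x =
      a \<odot>\<^bsub>cyclic_module q\<^esub> x \<oplus>\<^bsub>cyclic_module q\<^esub> b \<odot>\<^bsub>cyclic_module q\<^esub> x"
    by (simp add: cyclic_module_def residue_ring_def mod_Q mod_add_eq distrib_right)
  show "(a \<otimes>\<^bsub>residue_ring Q\<^esub> b) \<odot>\<^bsub>cyclic_module q\<^esub> x =
      a \<odot>\<^bsub>cyclic_module q\<^esub> (b \<odot>\<^bsub>cyclic_module q\<^esub> x)"
    by (simp add: cyclic_module_def residue_ring_def mod_Q mod_mult_right_eq mult.assoc)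
  show "a \<odot>\<^bsub>cyclic_module q\<^esub> (x \<oplus>\<^bsub>cyclic_module q\<^esub> y) =
      a \<odot>\<^bsub>cyclic_module q\<^esub> x \<oplus>\<^bsub>cyclic_module q\<^esub> a \<odot>\<^bsub>cyclic_module q\<^esub> y"
    by (simp add: cyclic_module_def mod_mult_right_eq mod_add_eq distrib_left)
qed (auto simp: cyclic_module_def residue_ring_def)

text \<open>After reduction modulo q this becomes the isomorphism of Z/q \<otimes> A with
  A/qA.\<close>

definition tensor_value :: "(int \<times> 'a::comm_ring_1) multiset \<Rightarrow> 'a" where
  "tensor_value u = (\<Sum>(n, x)\<in>#u. of_int n * x)"

text \<open>Among the generating relations, only those that reduce sums or products of integers
  modulo q change the value, and they do so by a multiple of q.\<close>

lemma tensor_eq_cyclic_value: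
  assumes "tensor_eq B (cyclic_module q) (\<lambda>b (x :: 'a::comm_ring_1). of_int b * x) u v"
  shows "of_int q dvd (tensor_value u - tensor_value v :: 'a)"
proof -
  have *: "(of_int q :: 'a) dvd of_int (k mod q) * x - of_int k * x" for k x
  proof -
    have "(of_int k :: 'a) = of_int (q * (k div q) + k mod q)" by simp
    then have "(of_int k :: 'a) = of_int q * of_int (k div q) + of_int (k mod q)"
      by (simp only: of_int_add of_int_mult)
    then have "of_int (k mod q) * x - of_int k * x = of_int q * (- of_int (k div q) * x)"
      by (simp add: algebra_simps)
    then show ?thesis by (metis dvd_triv_left)
  qed
  show ?thesis using assms
  proof induction
    case (sym u v)
    then show ?case by (metis dvd_minus_iff minus_diff_eq)
  next
    case (trans u v w)
    then show ?case by (metis dvd_add diff_add_cancel add_diff_eq)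
  next
    case (plus u v u' v')
    have "tensor_value (u + u') - tensor_value (v + v') =
      (tensor_value u - tensor_value v) + (tensor_value u' - tensor_value v')"
      by (simp add: tensor_value_def)
    then show ?case using plus by (metis dvd_add)
  next
    case (add_left n n' x)
    then show ?case using *[of "n + n'" x]
      by (simp add: tensor_value_def cyclic_module_def algebra_simps)
  next
    case (balanced b n x)
    then show ?case using *[of "b * n" x]
      by (simp add: tensor_value_def cyclic_module_def algebra_simps)
  qed (auto simp: tensor_value_def cyclic_module_def algebra_simps)
qed

text \<open>Flatness is applied to the injective map from Z/q to Z/kq given by multiplication by k.
  It sends 1 \<otimes> x to k \<otimes> x = 1 \<otimes> kx = 0, so 1 \<otimes> x = 0 in Z/q
  \<otimes> A = A/qA.\<close>

lemma flat_residue_ring_torsion: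
  fixes x :: "'a::comm_ring_1"
  assumes flat: "flat_module (residue_ring (k * q)) (\<lambda>b (x :: 'a). of_int b * x)"
    and kq: "k > 0" "q > 0" "k * q > 1" and x: "of_int k * x = 0"
  shows "of_int q dvd x"
\<comment> \<open>For q = 1 the claim is trivial, and 1 would not lie in the carrier {0} of
  Z/q.\<close>
proof (cases "q = 1")
  case False
  let ?B = "residue_ring (k * q)" and ?N' = "cyclic_module q" and ?N = "cyclic_module (k * q)"
  let ?act = "\<lambda>b (x :: 'a). of_int b * x" and ?f = "\<lambda>n. k * n"
  have hom: "Module.module ?B ?N' \<and> Module.module ?B ?N \<and>
      ?f \<in> carrier ?N' \<rightarrow> carrier ?N \<and> inj_on ?f (carrier ?N') \<and>
      (\<forall>x\<in>carrier ?N'. \<forall>y\<in>carrier ?N'. ?f (x \<oplus>\<^bsub>?N'\<^esub> y) = ?f x \<oplus>\<^bsub>?N\<^esub> ?f y) \<and>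
      (\<forall>b\<in>carrier ?B. \<forall>x\<in>carrier ?N'. ?f (b \<odot>\<^bsub>?N'\<^esub> x) = b \<odot>\<^bsub>?N\<^esub> ?f x)"
  proof (intro conjI)
    show "Module.module ?B ?N'" "Module.module ?B ?N" using kq by (auto intro: module_cyclic)
    have "k * x \<le> k * q - 1" if "x \<le> q - 1" for x
    proof -
      have "k * x < k * q" using that kq by simp
      then show ?thesis by simp
    qed
    then show "?f \<in> carrier ?N' \<rightarrow> carrier ?N" using kq by (auto simp: cyclic_module_def)
    show "inj_on ?f (carrier ?N')" using kq by (auto simp: inj_on_def)
    show "\<forall>b\<in>carrier ?B. \<forall>x\<in>carrier ?N'. ?f (b \<odot>\<^bsub>?N'\<^esub> x) = b \<odot>\<^bsub>?N\<^esub> ?f x"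
      by (simp add: cyclic_module_def mult.left_commute[of _ k])
  qed (simp add: cyclic_module_def flip: distrib_left)
  let ?u = "{#(1, x)#}"
  have one: "1 \<in> carrier ?N" using kq by (simp add: cyclic_module_def)
  have "tensor_eq ?B ?N ?act {#(k \<odot>\<^bsub>?N\<^esub> 1, x)#} {#(1, of_int k * x)#}"
  proof (rule tensor_eq.balanced[OF _ one])
    have "k * 1 < k * q" using False kq by (intro mult_strict_left_mono) auto
    then show "k \<in> carrier ?B" using kq by (simp add: residue_ring_def)
  qed
  moreover have "k \<odot>\<^bsub>?N\<^esub> 1 = k"
  proof -
    have "k * 1 < k * q" using False kq by (intro mult_strict_left_mono) auto
    then show ?thesis using kq by (simp add: cyclic_module_def)
  qed
  ultimately have 1: "tensor_eq ?B ?N ?act {#(k, x)#} {#(1, 0)#}" using x by simp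
  \<comment> \<open>That 1 \<otimes> 0 is zero is no generating relation; it follows from 0
    \<otimes> 0 by moving the scalar 0 across.\<close>
  have "tensor_eq ?B ?N ?act {#(0 \<odot>\<^bsub>?N\<^esub> 1, 0)#} {#(1, of_int 0 * 0)#}"
    using kq by (intro tensor_eq.balanced[OF _ one]) (simp add: residue_ring_def)
  then have "tensor_eq ?B ?N ?act {#(\<zero>\<^bsub>?N\<^esub>, 0)#} {#(1, 0)#}" by (simp add: cyclic_module_def)
  then have 2: "tensor_eq ?B ?N ?act {#(1, 0)#} {#}"
    by (rule tensor_eq.trans[OF tensor_eq.sym tensor_eq.zero])
  have "tensor_eq ?B ?N ?act (image_mset (map_prod ?f id) ?u) (image_mset (map_prod ?f id) {#})"
    using tensor_eq.trans[OF 1 2] by simp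
  moreover have "set_mset ?u \<subseteq> carrier ?N' \<times> UNIV"
    using False kq by (simp add: cyclic_module_def)
  moreover have "set_mset {#} \<subseteq> carrier ?N' \<times> (UNIV :: 'a set)" by simp
  ultimately have "tensor_eq ?B ?N' ?act ?u {#}"
    using flat[unfolded flat_module_def, rule_format, OF hom] by blast
  from tensor_eq_cyclic_value[OF this] show ?thesis by (simp add: tensor_value_def)
qed simp


section \<open>Local rings\<close>

lemma ideal_ring_of_type_iff:
  "ideal J (ring_of_type_algebra :: 'r::comm_ring_1 ring) \<longleftrightarrow>
    0 \<in> J \<and> (\<forall>x\<in>J. \<forall>y\<in>J. x + y \<in> J) \<and> (\<forall>x\<in>J. \<forall>a. a * x \<in> J)"
proof
  assume "ideal J (ring_of_type_algebra :: 'r ring)"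
  then interpret ideal J "ring_of_type_algebra :: 'r ring" .
  show "0 \<in> J \<and> (\<forall>x\<in>J. \<forall>y\<in>J. x + y \<in> J) \<and> (\<forall>x\<in>J. \<forall>a. a * x \<in> J)"
    using additive_subgroup.zero_closed[OF is_additive_subgroup]
      additive_subgroup.a_closed[OF is_additive_subgroup] I_l_closed
    by (simp add: ring_of_type_algebra_def)
next
  assume J: "0 \<in> J \<and> (\<forall>x\<in>J. \<forall>y\<in>J. x + y \<in> J) \<and> (\<forall>x\<in>J. \<forall>a. a * x \<in> J)"
  interpret cring "ring_of_type_algebra :: 'r ring" by (rule cring_from_type_algebra)
  show "ideal J (ring_of_type_algebra :: 'r ring)"
  proof (rule idealI)
    show "ring (ring_of_type_algebra :: 'r ring)" by (rule ring_from_type_algebra)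
    show "subgroup J (add_monoid (ring_of_type_algebra :: 'r ring))"
    proof (rule add.subgroupI)
      fix a assume a: "a \<in> J"
      have "((- 1) * a) \<oplus>\<^bsub>ring_of_type_algebra\<^esub> a = \<zero>\<^bsub>ring_of_type_algebra\<^esub>"
        by (simp add: ring_of_type_algebra_def)
      then have "\<ominus>\<^bsub>ring_of_type_algebra\<^esub> a = (- 1) * a"
        by (rule minus_equality) (simp_all add: ring_of_type_algebra_def)
      then show "\<ominus>\<^bsub>ring_of_type_algebra\<^esub> a \<in> J" using J a by (metis (no_types))
    qed (use J in \<open>auto simp: ring_of_type_algebra_def\<close>)
  qed (use J in \<open>auto simp: ring_of_type_algebra_def mult.commute\<close>)
qed

text \<open>Zorn's lemma on the ideals that contain \<open>x\<close> but not 1.\<close>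

lemma nonunit_in_maximalideal:
  fixes x :: "'r::comm_ring_1"
  assumes x: "\<not> x dvd 1"
  shows "\<exists>J. maximalideal J (ring_of_type_algebra :: 'r ring) \<and> x \<in> J"
proof -
  let ?R = "ring_of_type_algebra :: 'r ring"
  define \<A> where "\<A> = {J. ideal J ?R \<and> x \<in> J \<and> 1 \<notin> J}"
  have "range (\<lambda>a. a * x) \<in> \<A>"
  proof -
    have "0 \<in> range (\<lambda>a. a * x)" by (rule range_eqI[of _ _ 0]) simp
    moreover have "a * x + b * x \<in> range (\<lambda>a. a * x)" for a b
      by (rule range_eqI[of _ _ "a + b"]) (simp add: algebra_simps)
    moreover have "a * (b * x) \<in> range (\<lambda>a. a * x)" for a b
      by (rule range_eqI[of _ _ "a * b"]) (simp add: algebra_simps)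
    ultimately have "ideal (range (\<lambda>a. a * x)) ?R"
      unfolding ideal_ring_of_type_iff by blast
    moreover have "x \<in> range (\<lambda>a. a * x)" by (rule range_eqI[of _ _ 1]) simp
    moreover have "1 \<notin> range (\<lambda>a. a * x)" using x by (auto simp: dvd_def mult.commute)
    ultimately show ?thesis by (simp add: \<A>_def)
  qed
  moreover have "\<Union>\<C> \<in> \<A>" if C: "\<C> \<noteq> {}" "subset.chain \<A> \<C>" for \<C>
  proof -
    have I: "\<And>J. J \<in> \<C> \<Longrightarrow> ideal J ?R \<and> x \<in> J \<and> 1 \<notin> J"
      using C by (auto simp: \<A>_def subset.chain_def)
    have "a + b \<in> \<Union>\<C>" if ab: "a \<in> \<Union>\<C>" "b \<in> \<Union>\<C>" for a b
    proof -
      obtain J K where JK: "a \<in> J" "b \<in> K" "J \<in> \<C>" "K \<in> \<C>" using ab by blast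
      then have "J \<subseteq> K \<or> K \<subseteq> J" using C(2) by (auto simp: subset.chain_def)
      then obtain M where "M \<in> \<C>" "a \<in> M" "b \<in> M" using JK by blast
      then show ?thesis using I[of M] by (auto simp: ideal_ring_of_type_iff)
    qed
    moreover have "0 \<in> \<Union>\<C>"
    proof -
      obtain J where "J \<in> \<C>" using C(1) by blast
      then show ?thesis using I[of J] by (auto simp: ideal_ring_of_type_iff)
    qed
    moreover have "a * b \<in> \<Union>\<C>" if b: "b \<in> \<Union>\<C>" for a b
    proof -
      obtain J where J: "J \<in> \<C>" "b \<in> J" using b by blast
      then have "a * b \<in> J" using I[of J] unfolding ideal_ring_of_type_iff by blast
      then show ?thesis using J by blast
    qed
    ultimately have "ideal (\<Union>\<C>) ?R" by (simp only: ideal_ring_of_type_iff) blast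
    then show ?thesis using I C(1) by (auto simp: \<A>_def)
  qed
  ultimately have "\<exists>J\<in>\<A>. \<forall>K\<in>\<A>. J \<subseteq> K \<longrightarrow> K = J"
    by (intro subset_Zorn_nonempty) auto
  then obtain J where J: "J \<in> \<A>" "\<And>K. K \<in> \<A> \<Longrightarrow> J \<subseteq> K \<Longrightarrow> K = J"
    by blast
  have "maximalideal J ?R"
  proof (rule maximalidealI)
    show "ideal J ?R" using J by (simp add: \<A>_def)
    show "carrier ?R \<noteq> J" using J by (auto simp: \<A>_def ring_of_type_algebra_def)
    fix K assume K: "ideal K ?R" "J \<subseteq> K"
    show "K = J \<or> K = carrier ?R"
    proof (cases "1 \<in> K")
      case True
      then have "a * 1 \<in> K" for a using K(1) unfolding ideal_ring_of_type_iff by blast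
      then have "K = UNIV" by auto
      then show ?thesis by (simp add: ring_of_type_algebra_def)
    next
      case False
      then show ?thesis using J K by (auto simp: \<A>_def)
    qed
  qed
  then show ?thesis using J by (auto simp: \<A>_def)
qed

text \<open>A nonzero commutative ring is local iff this holds.\<close>

definition nonunits_add_closed :: "'r::comm_ring_1 itself \<Rightarrow> bool" where
  "nonunits_add_closed _ \<longleftrightarrow> (\<forall>x y :: 'r. x + y dvd 1 \<longrightarrow> x dvd 1 \<or> y dvd 1)"

text \<open>With only one maximal ideal, the nonunits are exactly its elements, and an ideal is
  closed under addition.\<close>

lemma local_ring_nonunits:
  fixes \<mm> :: "'r::comm_ring_1 set"
  assumes "local_ring \<mm>"
  shows "nonunits_add_closed TYPE('r)"
proof -
  have max: "maximalideal \<mm> (ring_of_type_algebra :: 'r ring)"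
    using assms by (simp add: local_ring_def)
  interpret maximalideal \<mm> "ring_of_type_algebra :: 'r ring" by (rule max)
  have I: "\<And>x y. x \<in> \<mm> \<Longrightarrow> y \<in> \<mm> \<Longrightarrow> x + y \<in> \<mm>" "\<And>x a. x \<in> \<mm> \<Longrightarrow> a * x \<in> \<mm>"
    using ideal_axioms by (auto simp: ideal_ring_of_type_iff)
  have one: "1 \<notin> \<mm>"
  proof
    assume "1 \<in> \<mm>"
    then have "a \<in> \<mm>" for a using I(2)[of 1 a] by simp
    then show False using I_notcarr by (auto simp: ring_of_type_algebra_def)
  qed
  have unit: "x dvd 1 \<longleftrightarrow> x \<notin> \<mm>" for x
  proof
    assume "x dvd 1"
    then obtain y where "1 = y * x" by (metis dvd_def mult.commute)
    then show "x \<notin> \<mm>" using I(2)[of x y] one by auto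
  next
    assume "x \<notin> \<mm>"
    then show "x dvd 1" using nonunit_in_maximalideal[of x] assms unfolding local_ring_def by blast
  qed
  show "nonunits_add_closed TYPE('r)"
    unfolding nonunits_add_closed_def unit using I(1) by blast
qed

lemma sum_unit:
  fixes f :: "'i \<Rightarrow> 'r::comm_ring_1"
  assumes "nonunits_add_closed TYPE('r)" "sum f I dvd 1"
  shows "\<exists>i\<in>I. f i dvd 1"
  using assms(2)
proof (induction I rule: infinite_finite_induct)
  case (insert i I)
  then have "f i + sum f I dvd 1" by simp
  then show ?case using insert assms(1) unfolding nonunits_add_closed_def by blast
qed auto

lemma one_plus_nilpotent_unit:
  fixes w :: "'a::comm_ring_1"
  assumes "w ^ n = 0"
  shows "1 + w dvd 1"
proof (cases n)
  case (Suc k)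
  have "1 - (- w) ^ n = (1 - (- w)) * (\<Sum>i<n. (- w) ^ i)"
    by (rule one_diff_power_eq)
  moreover have "(- w) ^ n = 0" using assms by (simp add: power_minus[of w])
  ultimately have "1 = (1 + w) * (\<Sum>i<n. (- w) ^ i)" by simp
  then show ?thesis by (rule dvdI)
qed (use assms in simp)

lemma fps_unit_iff: "f dvd 1 \<longleftrightarrow> fps_nth f 0 dvd (1 :: 'a::comm_ring_1)"
proof
  assume "f dvd 1"
  then obtain g where "1 = f * g" by (auto simp: dvd_def)
  then have "1 = fps_nth f 0 * fps_nth g 0" by (metis fps_mult_nth_0 fps_one_nth)
  then show "fps_nth f 0 dvd 1" by (metis dvd_triv_left)
next
  assume "fps_nth f 0 dvd 1"
  then obtain y where "fps_nth f 0 * y = 1" by (auto simp: dvd_def)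
  then have "f * fps_right_inverse f y = 1" by (rule fps_right_inverse)
  then show "f dvd 1" by (metis dvd_triv_left)
qed

lemma nonunits_add_closed_fps:
  assumes "nonunits_add_closed TYPE('a::comm_ring_1)"
  shows "nonunits_add_closed TYPE('a fps)"
  using assms by (simp add: nonunits_add_closed_def fps_unit_iff)

text \<open>If \<pi>(xy) = 1, then xy = 1 + c w with c nilpotent, which is a unit. This carries
  locality from the reduction modulo p up to the base.\<close>

lemma unit_mod_nilpotent_iff:
  fixes \<pi> :: "'a::comm_ring_1 \<Rightarrow> 'r::comm_ring_1"
  assumes hom: "\<pi> \<in> ring_hom ring_of_type_algebra ring_of_type_algebra" and "surj \<pi>"
    and ker: "\<forall>x. \<pi> x = 0 \<longrightarrow> c dvd x" and nil: "c ^ n = 0"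
  shows "x dvd 1 \<longleftrightarrow> \<pi> x dvd 1"
proof -
  have mult: "\<pi> (a * b) = \<pi> a * \<pi> b" and add: "\<pi> (a + b) = \<pi> a + \<pi> b" and one: "\<pi> 1 = 1" for a b
    using hom by (auto simp: ring_hom_def ring_of_type_algebra_def)
  show ?thesis
  proof
    assume "x dvd 1"
    then show "\<pi> x dvd 1" using mult one by (metis dvd_def)
  next
    assume "\<pi> x dvd 1"
    then obtain z where "1 = \<pi> x * z" by (auto simp: dvd_def)
    then obtain y where y: "\<pi> (x * y) = 1" using \<open>surj \<pi>\<close> mult by (metis surjD)
    have "\<pi> (x * y - 1) + \<pi> 1 = \<pi> (x * y)" unfolding add[symmetric] by simp
    then have "c dvd x * y - 1" using y one ker by simp
    then obtain w where "x * y - 1 = c * w" by (auto simp: dvd_def)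
    then have "x * y = 1 + c * w" by (simp add: algebra_simps)
    moreover have "1 + c * w dvd 1"
      by (rule one_plus_nilpotent_unit[of _ n]) (simp add: power_mult_distrib nil)
    ultimately show "x dvd 1" by (metis dvd_mult_left)
  qed
qed


section \<open>Bases of modules over a local ring\<close>

definition lincomb :: "('c::comm_ring_1 \<Rightarrow> 'm::ab_group_add \<Rightarrow> 'm) \<Rightarrow> ('n::finite \<Rightarrow> 'm) \<Rightarrow> 'c^'n \<Rightarrow> 'm" where
  "lincomb s e f = (\<Sum>i\<in>UNIV. s (f $ i) (e i))"

definition basis :: "('c::comm_ring_1 \<Rightarrow> 'm::ab_group_add \<Rightarrow> 'm) \<Rightarrow> ('n::finite \<Rightarrow> 'm) \<Rightarrow> bool" where
  "basis s e \<longleftrightarrow> bij (lincomb s e)"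

lemma module_vec: "Modules.module ((*s) :: 'c::comm_ring_1 \<Rightarrow> 'c^'n \<Rightarrow> 'c^'n)"
  by unfold_locales (simp_all add: vec_eq_iff algebra_simps)

context
  fixes s :: "'c::comm_ring_1 \<Rightarrow> 'm::ab_group_add \<Rightarrow> 'm"
  assumes mod: "Modules.module s"
begin

interpretation M: Modules.module s by (rule mod)

lemma module_hom_lincomb: "module_hom (*s) s (lincomb s e)"
  by (intro module_hom.intro module_vec mod module_hom_axioms.intro)
    (simp_all add: lincomb_def M.scale_left_distrib sum.distrib M.scale_sum_right)

lemma lincomb_axis: "lincomb s e (axis i 1) = e i"
proof -
  have "lincomb s e (axis i 1) = (\<Sum>j\<in>UNIV. if j = i then e i else 0)"
    unfolding lincomb_def by (rule sum.cong) (auto simp: axis_def)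
  then show ?thesis by simp
qed

lemma basis_iff:
  "basis s e \<longleftrightarrow> (\<forall>v. \<exists>f. v = lincomb s e f) \<and> (\<forall>f. lincomb s e f = 0 \<longrightarrow> f = 0)"
proof -
  interpret L: module_hom "(*s)" s "lincomb s e" by (rule module_hom_lincomb)
  show ?thesis
    unfolding basis_def bij_def surj_def L.inj_iff_eq_0 by auto
qed

text \<open>Steinitz exchange over a ring: the coordinate change \<open>T\<close> is invertible
  because the coefficient at the replaced vector is a unit.\<close>

lemma basis_exchange:
  fixes e :: "'n::finite \<Rightarrow> 'm" and c :: "'c^'n"
  assumes e: "basis s e" and c: "c $ i dvd 1"
  shows "basis s (e(i := lincomb s e c))"
proof -
  obtain u where u: "c $ i * u = 1" using c by (auto simp: dvd_def)
  interpret L: module_hom "(*s)" s "lincomb s e" by (rule module_hom_lincomb)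
  define T where "T f = (\<chi> j. if j = i then 0 else f $ j) + f $ i *s c" for f :: "'c^'n"
  have T: "lincomb s (e(i := lincomb s e c)) f = lincomb s e (T f)" for f
  proof -
    have "lincomb s e (T f) = lincomb s e (\<chi> j. if j = i then 0 else f $ j) + s (f $ i) (lincomb s e c)"
      by (simp add: T_def L.add L.scale)
    also have "lincomb s e (\<chi> j. if j = i then 0 else f $ j) = (\<Sum>j\<in>UNIV - {i}. s (f $ j) (e j))"
      unfolding lincomb_def by (subst sum.remove[of UNIV i]) auto
    also have "\<dots> + s (f $ i) (lincomb s e c) = lincomb s (e(i := lincomb s e c)) f"
      unfolding lincomb_def[of s "e(i := _)"] by (subst sum.remove[of UNIV i]) (auto simp: add.commute)
    finally show ?thesis by simp
  qed
  have "\<exists>f. g = T f" for g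
  proof -
    \<comment> \<open>Solving g = T f: the equation at index i gives f_i = u g_i, and the others
      follow.\<close>
    define f where "f = (\<chi> j. if j = i then u * g $ i else g $ j - u * g $ i * c $ j)"
    have "g $ j = T f $ j" for j
    proof (cases "j = i")
      case True
      have "u * g $ i * c $ i = g $ i * (c $ i * u)" by (simp add: ac_simps)
      then show ?thesis using True u by (simp add: T_def f_def)
    qed (simp add: T_def f_def)
    then have "g = T f" by (simp add: vec_eq_iff)
    then show ?thesis by blast
  qed
  moreover have "f = 0" if "T f = 0" for f
  proof -
    have j: "(if j = i then 0 else f $ j) + f $ i * c $ j = 0" for j
      using that by (auto simp: T_def vec_eq_iff)
    have "f $ i = f $ i * (c $ i * u)" using u by simp
    also have "\<dots> = 0" using j[of i] by (simp flip: mult.assoc)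
    finally have "f $ i = 0" .
    then have "f $ j = 0" for j using j[of j] by (cases "j = i") auto
    then show ?thesis by (simp add: vec_eq_iff)
  qed
  ultimately show ?thesis using e unfolding basis_iff T by metis
qed

text \<open>The basis vectors are exchanged one after another for elements of \<open>B\<close>;
  those already in \<open>B\<close> stay.\<close>

lemma basis_in_spanning_set:
  fixes e :: "'n::finite \<Rightarrow> 'm"
  assumes loc: "nonunits_add_closed TYPE('c)"
    and e: "basis s e" and B: "module.span s B = UNIV"
  shows "\<exists>e' :: 'n \<Rightarrow> 'm. basis s e' \<and> range e' \<subseteq> B"
proof -
  have "\<exists>e' :: 'n \<Rightarrow> 'm. basis s e' \<and> e' ` I \<subseteq> B" if "finite I" for I
    using that
  proof induction
    case (insert i I)
    then obtain e' :: "'n \<Rightarrow> 'm" where e': "basis s e'" "e' ` I \<subseteq> B" by blast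
    interpret L: module_hom "(*s)" s "lincomb s e'" by (rule module_hom_lincomb)
    define coord where "coord = inv_into UNIV (lincomb s e')"
    have coord: "lincomb s e' (coord v) = v" for v
      unfolding coord_def using e'(1) by (simp add: basis_def bij_is_surj surj_f_inv_f)
    obtain t a where t: "finite t" "t \<subseteq> B" "e' i = (\<Sum>x\<in>t. s (a x) x)"
      using B UNIV_I[of "e' i"] unfolding M.span_explicit by blast
    have "lincomb s e' (axis i 1) = lincomb s e' (\<Sum>x\<in>t. a x *s coord x)"
      by (simp add: lincomb_axis L.sum L.scale coord t(3))
    then have "axis i 1 = (\<Sum>x\<in>t. a x *s coord x)"
      using e'(1) by (simp add: basis_def bij_def inj_eq)
    then have "1 = (\<Sum>x\<in>t. a x *s coord x) $ i" by (metis axis_nth)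
    then have "(\<Sum>x\<in>t. a x * coord x $ i) dvd 1" by simp
    \<comment> \<open>The coordinate 1 of \<open>e' i\<close> at i is a sum over elements of
      \<open>B\<close>; by locality one summand is a unit, and with it the coordinate of that
      element.\<close>
    then obtain x where x: "x \<in> t" "a x * coord x $ i dvd 1" using sum_unit[OF loc] by blast
    then have "coord x $ i dvd 1" by (metis dvd_mult_right)
    then have "basis s (e'(i := x))" using basis_exchange[OF e'(1), of "coord x" i] coord by simp
    moreover have "(e'(i := x)) ` insert i I \<subseteq> B" using e'(2) t(2) x(1) insert.hyps by auto
    ultimately show ?case by blast
  qed (use e in blast)
  from this[of UNIV] show ?thesis by simp
qed

text \<open>Over a local ring some member of the cover is defined by a unit f, and then the
  localization at f is the module itself: the powers of f in \<open>free_at\<close> are cancelled by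
  those of its inverse.\<close>

lemma vector_bundle_basis:
  assumes loc: "nonunits_add_closed TYPE('c)"
    and vb: "vector_bundle s CARD('n::finite)"
  shows "\<exists>e :: 'n \<Rightarrow> 'm. basis s e"
proof -
  interpret R: Modules.module "(*) :: 'c \<Rightarrow> 'c \<Rightarrow> 'c"
    by unfold_locales (simp_all add: algebra_simps)
  obtain C where C: "1 \<in> R.span C" "\<forall>f\<in>C. free_at s CARD('n) f"
    using vb unfolding vector_bundle_def by blast
  obtain t a where t: "finite t" "t \<subseteq> C" "1 = (\<Sum>x\<in>t. a x * x)"
    using C(1) unfolding R.span_explicit by blast
  then have "(\<Sum>x\<in>t. a x * x) dvd 1" by (metis dvd_refl)
  then obtain f where f: "f \<in> t" "a f * f dvd 1" using sum_unit[OF loc] by blast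
  then obtain g where g: "f * g = 1" by (metis dvd_mult_right dvd_def)
  then have cancel: "g ^ k * f ^ k = 1" for k by (metis power_mult_distrib power_one mult.commute)
  obtain e :: "nat \<Rightarrow> 'm" where e: "\<And>v. \<exists>k c. s (f ^ k) v = (\<Sum>i<CARD('n). s (c i) (e i))"
    "\<And>c. (\<Sum>i<CARD('n). s (c i) (e i)) = 0 \<Longrightarrow> \<exists>k. \<forall>i<CARD('n). f ^ k * c i = 0"
    using C(2) t(2) f(1) unfolding free_at_def by blast
  obtain h :: "'n \<Rightarrow> nat" where h: "bij_betw h UNIV {..<CARD('n)}"
    using ex_bij_betw_finite_nat[of "UNIV :: 'n set"] by (auto simp: atLeast0LessThan)
  have comb: "lincomb s (e \<circ> h) (\<chi> i. c (h i)) = (\<Sum>i<CARD('n). s (c i) (e i))" for c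
    unfolding lincomb_def using sum.reindex_bij_betw[OF h, of "\<lambda>i. s (c i) (e i)"] by simp
  have "\<exists>f. v = lincomb s (e \<circ> h) f" for v
  proof -
    obtain k c where kc: "s (f ^ k) v = (\<Sum>i<CARD('n). s (c i) (e i))" using e(1) by blast
    have "v = s (g ^ k) (s (f ^ k) v)" by (simp add: cancel)
    also have "\<dots> = lincomb s (e \<circ> h) (\<chi> i. g ^ k * c (h i))"
      unfolding kc comb[of "\<lambda>i. g ^ k * c i"] by (simp add: M.scale_sum_right)
    finally show ?thesis by blast
  qed
  moreover have "c = 0" if 0: "lincomb s (e \<circ> h) c = 0" for c
  proof -
    define c' :: "nat \<Rightarrow> 'c" where "c' i = c $ inv_into UNIV h i" for i
    have c: "c $ i = c' (h i)" for i
      using h by (simp add: c'_def bij_betw_def)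
    then have "c = (\<chi> i. c' (h i))" by (simp add: vec_eq_iff)
    then obtain k where k: "\<forall>i<CARD('n). f ^ k * c' i = 0" using e(2)[of c'] 0 comb[of c'] by metis
    have "c $ i = 0" for i
    proof -
      have "h i < CARD('n)" using h by (auto simp: bij_betw_def)
      then have "g ^ k * (f ^ k * c $ i) = 0" using k c by simp
      then show ?thesis by (simp add: cancel flip: mult.assoc)
    qed
    then show ?thesis by (simp add: vec_eq_iff)
  qed
  ultimately have "basis s (e \<circ> h)" unfolding basis_iff by blast
  then show ?thesis by blast
qed

end

section \<open>Eigenvectors of a dormant connection\<close>

lemma fps_const_dvdI:
  assumes "\<And>k. c dvd fps_nth f k"
  shows "fps_const (c :: 'a::comm_ring_1) dvd f"
proof -
  obtain g where "\<And>k. fps_nth f k = c * g k" using assms unfolding dvd_def by metis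
  then have "f = fps_const c * Abs_fps g" by (simp add: fps_eq_iff)
  then show ?thesis by (rule dvdI)
qed

text \<open>Seen coefficientwise, t^k is a nonzerodivisor modulo c; for c = 0 this is its
  cancellability.\<close>

lemma fps_X_power_mult_eq_of_nat_mult:
  assumes "fps_X ^ k * f = of_nat c * (g :: 'a::comm_ring_1 fps)"
  shows "f = of_nat c * fps_shift k g"
proof -
  have g: "of_nat c * h = fps_const (of_nat c) * h" for h :: "'a fps" by (simp add: fps_of_nat)
  have "f = fps_shift k (fps_X ^ k * f)" by (simp add: fps_eq_iff fps_X_power_mult_nth)
  also have "\<dots> = of_nat c * fps_shift k g" unfolding assms g by (simp add: fps_eq_iff)
  finally show ?thesis .
qed

lemma of_nat_fps_mult_nth: "fps_nth (of_nat c * f) k = of_nat c * fps_nth f k"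
  for f :: "'a::comm_ring_1 fps"
  by (simp flip: fps_of_nat)

lemma log_deriv_X_power: "log_deriv (fps_X ^ k) = of_nat k * (fps_X ^ k :: 'a::comm_ring_1 fps)"
  unfolding log_deriv_def
  by (auto simp: fps_eq_iff of_nat_fps_mult_nth fps_X_power_nth)

text \<open>A kernel of \<phi> generated by c makes (ker \<phi>) M equal to c M. Applied with c = p
  for the reduction modulo p and c = t for the fibre at t = 0.\<close>

lemma is_restriction_eq_0_iff:
  assumes r: "is_restriction \<phi> s s' r" and \<phi>: "\<And>f. \<phi> f = 0 \<longleftrightarrow> c dvd f"
  shows "r v = 0 \<longleftrightarrow> (\<exists>y. v = s c y)"
proof -
  interpret M: Modules.module s using r by (simp add: is_restriction_def)
  have "module.span s {s f w | f w. \<phi> f = 0} = range (s c)"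
  proof
    have "M.subspace (range (s c))"
      unfolding M.subspace_def
    proof (intro conjI ballI allI)
      show "0 \<in> range (s c)" by (rule range_eqI[of _ _ 0]) simp
    next
      fix x y assume "x \<in> range (s c)" "y \<in> range (s c)"
      then show "x + y \<in> range (s c)" by (auto simp flip: M.scale_right_distrib)
    next
      fix a x assume "x \<in> range (s c)"
      then obtain y where "x = s c y" by blast
      then have "s a x = s c (s a y)" by (simp add: mult.commute)
      then show "s a x \<in> range (s c)" by blast
    qed
    then show "M.span {s f w | f w. \<phi> f = 0} \<subseteq> range (s c)"
      using \<phi> by (intro M.span_minimal) (auto elim!: dvdE simp flip: M.scale_scale)
    show "range (s c) \<subseteq> M.span {s f w | f w. \<phi> f = 0}"
      using \<phi>[of c] by (auto intro!: M.span_base)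
  qed
  then show ?thesis using r by (auto simp: is_restriction_def)
qed

lemma diffop_action_X_power:
  "\<exists>c. diffop_action p a i (fps_X ^ k) = fps_const c * (fps_X ^ k :: 'r::comm_ring_1 fps)"
  by (rule exI[of _ "of_plocal p (qfact p a i * of_nat (k choose i))"])
    (auto simp: diffop_action_def fps_eq_iff fps_X_power_nth)

text \<open>Here it counts that the operators are logarithmic: each generator multiplies t^k by a
  constant, so every term of the Leibniz rule keeps the factor t^k.\<close>

lemma D_module_X_power:
  fixes s :: "'r::comm_ring_1 fps \<Rightarrow> 'v::ab_group_add \<Rightarrow> 'v"
  assumes mod: "Modules.module s" and D: "D_module p a s E"
  shows "\<exists>w. E j (s (fps_X ^ k) v) = s (fps_X ^ k) w"
proof -
  interpret M: Modules.module s by (rule mod)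
  have "\<forall>i. \<exists>c. diffop_action p a i (fps_X ^ k) = fps_const c * (fps_X ^ k :: 'r fps)"
    using diffop_action_X_power by blast
  then obtain c where c: "\<And>i. diffop_action p a i (fps_X ^ k) = fps_const (c i) * (fps_X ^ k :: 'r fps)"
    unfolding choice_iff by blast
  define b where "b i = fps_const (of_plocal p (qfact p a j / (qfact p a i * qfact p a (j - i)))) * fps_const (c i)" for i
  have "E j (s (fps_X ^ k) v) =
    (\<Sum>i\<le>j. s (fps_const (of_plocal p (qfact p a j / (qfact p a i * qfact p a (j - i)))) *
                   diffop_action p a i (fps_X ^ k)) (E (j - i) v))"
    using D unfolding D_module_def by blast
  also have "\<dots> = (\<Sum>i\<le>j. s (fps_X ^ k * b i) (E (j - i) v))"
    unfolding c b_def by (simp only: mult_ac)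
  also have "\<dots> = s (fps_X ^ k) (\<Sum>i\<le>j. s (b i) (E (j - i) v))"
    by (simp add: M.scale_sum_right)
  finally show ?thesis by blast
qed

text \<open>The basis \<open>e\<^sub>0\<close> stands for the vector bundle hypothesis, so that
  divisibility in M becomes divisibility of power series.\<close>

locale dormant_bundle =
  fixes p m :: nat
    and \<pi> :: "'a::comm_ring_1 \<Rightarrow> 'r::comm_ring_1"
    and s :: "'a fps \<Rightarrow> 'm::ab_group_add \<Rightarrow> 'm"
    and \<delta> :: "'m \<Rightarrow> 'm"
    and s\<^sub>0 :: "'r fps \<Rightarrow> 'v::ab_group_add \<Rightarrow> 'v"
    and r :: "'m \<Rightarrow> 'v"
    and e\<^sub>0 :: "'n::finite \<Rightarrow> 'm"
  assumes prime_p: "Factorial_Ring.prime p"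
    and p_power_0: "of_nat (p ^ (m + 1)) = (0 :: 'a)"
    and flat: "flat_module (residue_ring (int p ^ (m + 1))) (\<lambda>b (x :: 'a). of_int b * x)"
    and \<pi>_hom: "\<pi> \<in> ring_hom ring_of_type_algebra ring_of_type_algebra"
    and \<pi>_ker: "\<forall>x. \<pi> x = 0 \<longleftrightarrow> of_nat p dvd x"
    and module_s: "Modules.module s"
    and basis_e0: "basis s e\<^sub>0"
    and connection: "log_connection s \<delta>"
    and restriction: "is_restriction (fps_map \<pi>) s s\<^sub>0 r"
    and dormant: "dormant p m s \<delta> s\<^sub>0 r"
begin

sublocale s: Modules.module s by (rule module_s)
sublocale s0: Modules.module s\<^sub>0 using restriction by (simp add: is_restriction_def)
sublocale r: Modules.additive r using restriction by (simp add: is_restriction_def)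
sublocale \<delta>: Modules.additive \<delta> using connection by (simp add: log_connection_def)
sublocale L: module_hom "(*s)" s "lincomb s e\<^sub>0" by (rule module_hom_lincomb[OF module_s])

lemma p_pos: "p > 0" using prime_p prime_gt_0_nat by blast

lemma leibniz: "\<delta> (s h v) = s (log_deriv h) v + s h (\<delta> v)"
  using connection by (simp add: log_connection_def)

lemma coordinates: obtains f where "x = lincomb s e\<^sub>0 f"
  using basis_e0 unfolding basis_iff[OF module_s] by blast

lemma lincomb_eq_iff: "lincomb s e\<^sub>0 f = lincomb s e\<^sub>0 g \<longleftrightarrow> f = g"
  using basis_e0 by (simp add: basis_def bij_def inj_eq)

lemma p_torsion_base: "of_nat p * x = 0 \<Longrightarrow> of_nat (p ^ m) dvd (x :: 'a)"
  using flat_residue_ring_torsion[of "int p" "int p ^ m" x] flat prime_p p_pos prime_gt_1_nat[of p]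
    one_less_power[of "int p" "Suc m"] by simp

lemma p_power_scale_0: "s (of_nat (p ^ (m + 1))) x = 0"
proof -
  have "(of_nat (p ^ (m + 1)) :: 'a fps) = 0"
    by (simp only: p_power_0 fps_const_0_eq_0 flip: fps_of_nat)
  then show ?thesis by (simp only: s.scale_zero_left)
qed

text \<open>Eigenvalues are kept as natural numbers; as p^(m+1) kills M, the number k (p^(m+1) - 1)
  represents -k.\<close>

lemma scale_of_nat_minus: "s (of_nat (k * (p ^ (m + 1) - 1))) x = - s (of_nat k) x"
proof -
  have "k * (p ^ (m + 1) - 1) + k = p ^ (m + 1) * k"
  proof -
    have "p ^ (m + 1) = Suc (p ^ (m + 1) - 1)" using p_pos by simp
    then show ?thesis by (metis add.commute mult_Suc mult.commute)
  qed
  then have "s (of_nat (k * (p ^ (m + 1) - 1))) x + s (of_nat k) x = s (of_nat (p ^ (m + 1))) (s (of_nat k) x)"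
    unfolding s.scale_scale of_nat_mult[symmetric] s.scale_left_distrib[symmetric] of_nat_add[symmetric]
    by simp
  also have "\<dots> = 0" by (rule p_power_scale_0)
  finally show ?thesis by (simp add: eq_neg_iff_add_eq_0)
qed

lemma p_torsion:
  assumes "s (of_nat p) x = 0"
  shows "\<exists>y. x = s (of_nat (p ^ m)) y"
proof -
  obtain f where f: "x = lincomb s e\<^sub>0 f" by (rule coordinates)
  have "lincomb s e\<^sub>0 (of_nat p *s f) = lincomb s e\<^sub>0 0" using assms by (simp add: f L.scale L.zero)
  then have "of_nat p *s f = 0" by (simp only: lincomb_eq_iff)
  then have pf: "of_nat p * f $ i = 0" for i by (simp add: vec_eq_iff)
  have "of_nat (p ^ m) dvd f $ i" for i
  proof -
    have "of_nat (p ^ m) dvd fps_nth (f $ i) k" for k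
      using arg_cong[OF pf[of i], of "\<lambda>h. fps_nth h k"]
      by (intro p_torsion_base) (simp add: of_nat_fps_mult_nth)
    then show ?thesis using fps_const_dvdI by (metis fps_of_nat)
  qed
  then obtain g where "\<And>i. f $ i = of_nat (p ^ m) * g i" unfolding dvd_def by metis
  then have "f = of_nat (p ^ m) *s (\<chi> i. g i)" by (simp add: vec_eq_iff)
  then show ?thesis using f L.scale by metis
qed

lemma \<pi>_simps: "\<pi> (x + y) = \<pi> x + \<pi> y" "\<pi> (x * y) = \<pi> x * \<pi> y" "\<pi> 1 = 1" "\<pi> 0 = 0"
  using \<pi>_hom \<pi>_ker by (auto simp: ring_hom_def ring_of_type_algebra_def)

lemma fps_map_eq_0_iff: "fps_map \<pi> f = 0 \<longleftrightarrow> of_nat p dvd f"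
proof
  assume "fps_map \<pi> f = 0"
  then have "\<pi> (fps_nth f k) = 0" for k by (simp add: fps_map_def fps_eq_iff)
  then show "of_nat p dvd f" using fps_const_dvdI[of "of_nat p" f] \<pi>_ker by (simp add: fps_of_nat)
next
  assume "of_nat p dvd f"
  then obtain g where "f = of_nat p * g" by (auto simp: dvd_def)
  then show "fps_map \<pi> f = 0" using \<pi>_ker by (simp add: fps_map_def fps_eq_iff of_nat_fps_mult_nth)
qed

lemma r_eq_0_iff: "r x = 0 \<longleftrightarrow> (\<exists>y. x = s (of_nat p) y)"
  by (rule is_restriction_eq_0_iff[OF restriction fps_map_eq_0_iff])

lemma surj_r: "surj r" using restriction by (simp add: is_restriction_def)

lemma r_X_power: "r (s (fps_X ^ k) x) = s\<^sub>0 (fps_X ^ k) (r x)"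
proof -
  have "fps_map \<pi> (fps_X ^ k) = fps_X ^ k"
    by (simp add: fps_map_def fps_eq_iff fps_X_power_nth \<pi>_simps)
  then show ?thesis using restriction by (simp add: is_restriction_def)
qed

lemma char_p: "s\<^sub>0 (of_nat p) v = 0"
proof -
  obtain x where "v = r x" using surj_r by (metis surjD)
  then have "s\<^sub>0 (of_nat p) v = r (s (of_nat p) x)"
    by (simp only: r.scale_of_nat[OF module_s s0.module_axioms])
  then show ?thesis using r_eq_0_iff by auto
qed

lemma X_power_cancel: "s (fps_X ^ k) x = s (fps_X ^ k) y \<Longrightarrow> x = y"
proof -
  assume eq: "s (fps_X ^ k) x = s (fps_X ^ k) y"
  obtain f where f: "x - y = lincomb s e\<^sub>0 f" by (rule coordinates)
  have "lincomb s e\<^sub>0 (fps_X ^ k *s f) = lincomb s e\<^sub>0 0"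
    using eq by (simp add: L.scale L.zero s.scale_right_diff_distrib flip: f)
  then have "fps_X ^ k *s f = 0" by (simp only: lincomb_eq_iff)
  then have "fps_X ^ k * f $ i = of_nat 0 * 0" for i by (simp add: vec_eq_iff)
  then have "f $ i = 0" for i using fps_X_power_mult_eq_of_nat_mult by fastforce
  then have "f = 0" by (simp add: vec_eq_iff)
  then show "x = y" using f by (simp add: L.zero)
qed

lemma \<delta>_X_power: "\<delta> (s (fps_X ^ k) x) = s (fps_X ^ k) (s (of_nat k) x + \<delta> x)"
  by (simp add: leibniz log_deriv_X_power s.scale_right_distrib mult.commute)

lemma X_power_saturated:
  assumes "r (s (fps_X ^ k) x) = 0"
  shows "\<exists>y. s (fps_X ^ k) x = s (of_nat p) (s (fps_X ^ k) y)"
proof -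
  obtain y where y: "s (fps_X ^ k) x = s (of_nat p) y" using assms r_eq_0_iff by blast
  obtain f where f: "x = lincomb s e\<^sub>0 f" by (rule coordinates)
  obtain g where g: "y = lincomb s e\<^sub>0 g" by (rule coordinates)
  have "lincomb s e\<^sub>0 (fps_X ^ k *s f) = lincomb s e\<^sub>0 (of_nat p *s g)"
    using y by (simp add: f g L.scale)
  then have "fps_X ^ k * f $ i = of_nat p * g $ i" for i by (simp add: lincomb_eq_iff vec_eq_iff)
  then have "f $ i = of_nat p * fps_shift k (g $ i)" for i
    by (rule fps_X_power_mult_eq_of_nat_mult)
  then have "f = of_nat p *s (\<chi> i. fps_shift k (g $ i))" by (simp add: vec_eq_iff)
  then have "x = s (of_nat p) (lincomb s e\<^sub>0 (\<chi> i. fps_shift k (g $ i)))"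
    using f L.scale by metis
  then have "s (fps_X ^ k) x = s (of_nat p) (s (fps_X ^ k) (lincomb s e\<^sub>0 (\<chi> i. fps_shift k (g $ i))))"
    by (simp add: mult.commute)
  then show ?thesis by blast
qed

lemma sublattice: "\<exists>E. dormant_sublattice p m s \<delta> s\<^sub>0 r E (range (s (fps_X ^ k)))"
proof -
  obtain E where "diagonal_reduction p s \<delta> s\<^sub>0 r m E" using dormant by (auto simp: dormant_def)
  note E = diagonal_reductionD[OF prime_p s0.module_axioms char_p this]
  have D: "D_module p m s\<^sub>0 E" using E by blast
  have "dormant_sublattice p m s \<delta> s\<^sub>0 r E (range (s (fps_X ^ k)))"
  proof (unfold_locales)
    show "E i (E j v) = E j (E i v)" for i j v by (rule D_module_commute[OF D])
    show "E j (x + y) = E j x + E j y" for j x y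
      using D_module_additive[OF D] by (simp add: Modules.additive_def)
    show "E (p ^ 0) (r x) = r (\<delta> x)" for x using E by simp
    show "\<exists>y. x = s (of_nat (p ^ m)) y" if "s (of_nat p) x = 0" for x
      using p_torsion[OF that] .
    show "subtraction_closed (range (s (fps_X ^ k)))"
      by (auto simp: subtraction_closed_def simp flip: s.scale_right_diff_distrib)
    show "0 \<in> range (s (fps_X ^ k))" by (rule range_eqI[of _ _ 0]) simp
    show "\<delta> x \<in> range (s (fps_X ^ k))" if "x \<in> range (s (fps_X ^ k))" for x
      using that \<delta>_X_power by auto
    show "\<exists>y\<in>range (s (fps_X ^ k)). x = s (of_nat p) y"
      if "x \<in> range (s (fps_X ^ k))" "r x = 0" for x
      using that X_power_saturated by blast
    show "E j v \<in> r ` range (s (fps_X ^ k))" if v: "v \<in> r ` range (s (fps_X ^ k))" for j v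
    proof -
      obtain x where "v = r (s (fps_X ^ k) x)" using v by blast
      then obtain w where "E j v = s\<^sub>0 (fps_X ^ k) w"
        using D_module_X_power[OF s0.module_axioms D] unfolding r_X_power by metis
      moreover obtain y where "w = r y" using surj_r by (metis surjD)
      ultimately have "E j v = r (s (fps_X ^ k) y)" by (simp only: r_X_power)
      then show ?thesis by blast
    qed
  qed (use E prime_p surj_r r_eq_0_iff in \<open>blast+\<close>)
  then show ?thesis by blast
qed

section \<open>Eigenvectors modulo powers of p\<close>

text \<open>For a = 0 every section qualifies, and for a = m + 1 the error term is zero, so an
  induction on a leads from M to true eigenvectors.\<close>

definition eigenvectors_mod :: "nat \<Rightarrow> 'm set" where
  "eigenvectors_mod a = {x. \<exists>c y. \<delta> x = s (of_nat c) x + s (of_nat (p ^ a)) y}"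

text \<open>Multiplying an eigenvector by a suitable power \<open>t\<^sup>k\<close> makes its image in the special fibre
  horizontal, and all the constructions can be carried out inside \<open>t\<^sup>k M\<close>, so that one can divide
  by \<open>t\<^sup>k\<close> in the end.\<close>

lemma eigenvectors_mod_Suc:
  assumes a: "a \<le> m" and x: "x \<in> eigenvectors_mod a"
  shows "\<exists>u\<in>s.span (eigenvectors_mod (Suc a)). \<exists>z. x = u + s (of_nat p) z"
proof -
  obtain c y where y: "\<delta> x = s (of_nat c) x + s (of_nat (p ^ a)) y"
    using x by (auto simp: eigenvectors_mod_def)
  \<comment> \<open>Chosen so that k + c = c p^a: the factor t^k moves the eigenvalue c to a
    multiple of p^a.\<close>
  define k where "k = c * (p ^ a - 1)"
  have kc: "k + c = c * p ^ a"
  proof -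
    have "p ^ a = Suc (p ^ a - 1)" using p_pos by simp
    then show ?thesis unfolding k_def by (metis add.commute mult_Suc_right)
  qed
  let ?L = "range (s (fps_X ^ k))"
  obtain E where "dormant_sublattice p m s \<delta> s\<^sub>0 r E ?L" using sublattice by blast
  then interpret S: dormant_sublattice p m s \<delta> s\<^sub>0 r E ?L .
  have "s (of_nat k) x + \<delta> x = s (of_nat (k + c)) x + s (of_nat (p ^ a)) y"
    unfolding y by (simp add: s.scale_left_distrib)
  also have "\<dots> = s (of_nat (p ^ a)) (s (of_nat c) x + y)"
    unfolding kc by (simp add: s.scale_right_distrib mult.commute)
  finally have "\<delta> (s (fps_X ^ k) x) = S.pm a (s (fps_X ^ k) (s (of_nat c) x + y))"
    unfolding \<delta>_X_power S.pm_def by (simp add: mult.commute)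
  then obtain f z where fz: "z \<in> ?L" "s (fps_X ^ k) x = (\<Sum>c<p. f c) + S.pm 1 z"
    and f: "\<And>c. c < p \<Longrightarrow> f c \<in> ?L \<and> (\<exists>w\<in>?L. \<delta> (f c) = s (of_nat (c * p ^ a)) (f c) + S.pm (Suc a) w)"
    using S.eigenvector_lifts[OF a rangeI] by blast
  have "\<exists>g\<in>eigenvectors_mod (Suc a). f c = s (fps_X ^ k) g" if c: "c < p" for c
  proof -
    obtain g w where g: "f c = s (fps_X ^ k) g"
      and w: "\<delta> (f c) = s (of_nat (c * p ^ a)) (f c) + S.pm (Suc a) (s (fps_X ^ k) w)"
      using f[OF c] by blast
    have "s (fps_X ^ k) (s (of_nat k) g + \<delta> g) =
        s (fps_X ^ k) (s (of_nat (c * p ^ a)) g + s (of_nat (p ^ Suc a)) w)"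
      using w unfolding g \<delta>_X_power S.pm_def
      by (simp add: s.scale_right_distrib mult_ac del: power_Suc)
    then have eq: "s (of_nat k) g + \<delta> g = s (of_nat (c * p ^ a)) g + s (of_nat (p ^ Suc a)) w"
      by (rule X_power_cancel)
    \<comment> \<open>Dividing by t^k lowers the eigenvalue c p^a by k; \<open>k'\<close> represents
      -k as a natural number.\<close>
    define k' where "k' = k * (p ^ (m + 1) - 1)"
    have k': "s (of_nat k') g = - s (of_nat k) g"
      unfolding k'_def by (rule scale_of_nat_minus)
    have "\<delta> g = s (of_nat (c * p ^ a + k')) g + s (of_nat (p ^ Suc a)) w"
      using eq k' unfolding of_nat_add s.scale_left_distrib by (simp add: algebra_simps)
    then show ?thesis using g unfolding eigenvectors_mod_def by blast
  qed
  then obtain g where g: "\<And>c. c < p \<Longrightarrow> g c \<in> eigenvectors_mod (Suc a)"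
    "\<And>c. c < p \<Longrightarrow> f c = s (fps_X ^ k) (g c)" by metis
  obtain z' where z': "z = s (fps_X ^ k) z'" using fz by blast
  have "s (fps_X ^ k) x = s (fps_X ^ k) ((\<Sum>c<p. g c) + s (of_nat p) z')"
    using fz(2) g(2) unfolding z' S.pm_def
    by (simp add: s.scale_right_distrib s.scale_sum_right mult.commute)
  then have "x = (\<Sum>c<p. g c) + s (of_nat p) z'" by (rule X_power_cancel)
  moreover have "(\<Sum>c<p. g c) \<in> s.span (eigenvectors_mod (Suc a))"
    using g(1) by (intro s.span_sum s.span_base) auto
  ultimately show ?thesis by blast
qed

text \<open>p is nilpotent on M, so substituting the hypothesis into its own remainder ends after m
  + 1 rounds.\<close>

lemma nakayama:
  assumes N: "s.subspace N" and "\<And>x. \<exists>u\<in>N. \<exists>z. x = u + s (of_nat p) z"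
  shows "N = UNIV"
proof -
  have "\<exists>u\<in>N. \<exists>z. x = u + s (of_nat (p ^ j)) z" for x j
  proof (induction j)
    case 0
    show ?case using s.subspace_0[OF N] by (intro bexI[of _ 0]) auto
  next
    case (Suc j)
    then obtain u z where u: "u \<in> N" "x = u + s (of_nat (p ^ j)) z" by blast
    obtain u' z' where u': "u' \<in> N" "z = u' + s (of_nat p) z'" using assms(2) by blast
    have "x = (u + s (of_nat (p ^ j)) u') + s (of_nat (p ^ Suc j)) z'"
      unfolding u(2) u'(2) by (simp add: s.scale_right_distrib mult_ac add_ac)
    moreover have "u + s (of_nat (p ^ j)) u' \<in> N"
      using u u' N by (intro s.subspace_add s.subspace_scale)
    ultimately show ?case by blast
  qed
  from this[of _ "m + 1"] have "x \<in> N" for x unfolding p_power_scale_0 by auto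
  then show ?thesis by blast
qed

text \<open>With N the span at the next level, N + pM is a submodule that contains the eigenvectors
  modulo p^a, hence is everything, and \<open>nakayama\<close> gives N = M.\<close>

lemma span_eigenvectors_mod: "a \<le> m + 1 \<Longrightarrow> s.span (eigenvectors_mod a) = UNIV"
proof (induction a)
  case 0
  have "x \<in> eigenvectors_mod 0" for x
    unfolding eigenvectors_mod_def by (intro CollectI exI[of _ 0] exI[of _ "\<delta> x"]) simp
  then show ?case using s.span_base by blast
next
  case (Suc a)
  let ?N = "s.span (eigenvectors_mod (Suc a))"
  have "s.subspace {x. \<exists>u\<in>?N. \<exists>z. x = u + s (of_nat p) z}"
  proof (rule s.subspaceI)
    show "0 \<in> {x. \<exists>u\<in>?N. \<exists>z. x = u + s (of_nat p) z}"
      using s.span_zero by (auto intro!: bexI[of _ 0] exI[of _ 0])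
  next
    fix x y assume "x \<in> {x. \<exists>u\<in>?N. \<exists>z. x = u + s (of_nat p) z}" "y \<in> {x. \<exists>u\<in>?N. \<exists>z. x = u + s (of_nat p) z}"
    then obtain u z u' z' where u: "u \<in> ?N" "x = u + s (of_nat p) z" "u' \<in> ?N" "y = u' + s (of_nat p) z'"
      by blast
    then have "x + y = (u + u') + s (of_nat p) (z + z')" by (simp add: s.scale_right_distrib add_ac)
    then show "x + y \<in> {x. \<exists>u\<in>?N. \<exists>z. x = u + s (of_nat p) z}" using u s.span_add by blast
  next
    fix c x assume "x \<in> {x. \<exists>u\<in>?N. \<exists>z. x = u + s (of_nat p) z}"
    then obtain u z where u: "u \<in> ?N" "x = u + s (of_nat p) z" by blast
    then have "s c x = s c u + s (of_nat p) (s c z)" by (simp add: s.scale_right_distrib mult.commute)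
    then show "s c x \<in> {x. \<exists>u\<in>?N. \<exists>z. x = u + s (of_nat p) z}" using u s.span_scale by blast
  qed
  then have "s.span (eigenvectors_mod a) \<subseteq> {x. \<exists>u\<in>?N. \<exists>z. x = u + s (of_nat p) z}"
    using eigenvectors_mod_Suc[of a] Suc.prems by (intro s.span_minimal) auto
  then show ?case using Suc by (intro nakayama s.subspace_span) auto
qed

lemma span_eigenvectors: "s.span {x. \<exists>c. \<delta> x = s (of_nat c) x} = UNIV"
  using span_eigenvectors_mod[of "m + 1"] unfolding eigenvectors_mod_def p_power_scale_0 by simp

end

section \<open>Diagonal flat bundles\<close>

lemma flat_bundle_iso_lincomb:
  fixes s :: "'a::comm_ring_1 fps \<Rightarrow> 'm::ab_group_add \<Rightarrow> 'm"
  assumes mod: "Modules.module s" and conn: "log_connection s \<delta>" and basis: "basis s e"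
    and e: "\<And>i. \<delta> (e i) = - s (of_nat (d i)) (e i)"
  shows "flat_bundle_iso (*s) (delta_sum d) s \<delta> (lincomb s e)"
proof -
  interpret Modules.module s by (rule mod)
  interpret \<delta>: Modules.additive \<delta> using conn by (simp add: log_connection_def)
  have "\<delta> (s h (e i)) = s (delta_rank1 (d i) h) (e i)" for h i
  proof -
    have "\<delta> (s h (e i)) = s (log_deriv h) (e i) + s h (\<delta> (e i))"
      using conn by (simp add: log_connection_def)
    then show ?thesis
      by (simp add: e delta_rank1_def scale_left_diff_distrib mult.commute)
  qed
  then have "lincomb s e (delta_sum d f) = \<delta> (lincomb s e f)" for f
    by (simp add: lincomb_def delta_sum_def \<delta>.sum)
  then show ?thesis
    using module_hom_lincomb[OF mod] basis by (simp add: flat_bundle_iso_def basis_def)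
qed

lemma fps_nth_0_eq_0_iff: "fps_nth f 0 = 0 \<longleftrightarrow> fps_X dvd (f :: 'a::comm_ring_1 fps)"
proof
  assume "fps_nth f 0 = 0"
  then have "f = fps_X * fps_shift 1 f"
    by (simp add: fps_eq_iff)
  then show "fps_X dvd f" by (rule dvdI)
qed (auto elim!: dvdE)

lemma delta_sum_nth_0:
  "fps_nth (delta_sum d f $ i) 0 = - of_nat (d i) * fps_nth (f $ i) 0"
  by (simp add: delta_sum_def delta_rank1_def log_deriv_def of_nat_fps_mult_nth)

text \<open>Through \<phi> the fibre at t = 0 is the module of constant terms of the coordinates. As
  t d/dt leaves no constant term, only the multiplications by -d_i remain of \<delta>.\<close>

lemma monodromy_diagonal:
  fixes s :: "'a::comm_ring_1 fps \<Rightarrow> 'm::ab_group_add \<Rightarrow> 'm" and d :: "'n::finite \<Rightarrow> nat"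
  assumes iso: "flat_bundle_iso (*s) (delta_sum d) s \<delta> \<phi>"
    and res: "is_restriction (\<lambda>f. fps_nth f 0) s s\<^sub>t r\<^sub>t"
  shows "\<exists>\<tau> :: 'f::ab_group_add \<Rightarrow> 'a^'n. module_hom s\<^sub>t (*s) \<tau> \<and> bij \<tau> \<and>
    (\<forall>x. \<tau> (monodromy r\<^sub>t \<delta> x) = (\<chi> i j. if i = j then - of_nat (d i) else 0) *v \<tau> x)"
proof -
  interpret \<phi>: module_hom "(*s)" s \<phi> using iso by (simp add: flat_bundle_iso_def)
  interpret r: Modules.additive r\<^sub>t using res by (simp add: is_restriction_def)
  interpret St: Modules.module s\<^sub>t using res by (simp add: is_restriction_def)
  have r0: "r\<^sub>t v = 0 \<longleftrightarrow> (\<exists>y. v = s fps_X y)" for v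
    by (rule is_restriction_eq_0_iff[OF res fps_nth_0_eq_0_iff])
  have bij: "bij \<phi>" and comm: "\<phi> (delta_sum d f) = \<delta> (\<phi> f)" for f
    using iso by (auto simp: flat_bundle_iso_def)
  have r_\<phi>: "r\<^sub>t (\<phi> f) = 0 \<longleftrightarrow> (\<forall>i. fps_nth (f $ i) 0 = 0)" for f
  proof
    assume "r\<^sub>t (\<phi> f) = 0"
    then obtain y where "\<phi> f = s fps_X y" using r0 by blast
    moreover obtain g where "y = \<phi> g" using bij by (metis bij_pointE)
    ultimately have "\<phi> f = \<phi> (fps_X *s g)" by (simp add: \<phi>.scale)
    then have "f = fps_X *s g" using bij by (metis bij_pointE)
    then show "\<forall>i. fps_nth (f $ i) 0 = 0" by simp
  next
    assume "\<forall>i. fps_nth (f $ i) 0 = 0"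
    then obtain g where "\<And>i. f $ i = fps_X * g i" unfolding fps_nth_0_eq_0_iff dvd_def by metis
    then have "f = fps_X *s (\<chi> i. g i)" by (simp add: vec_eq_iff)
    then have "\<phi> f = s fps_X (\<phi> (\<chi> i. g i))" by (metis \<phi>.scale)
    then show "r\<^sub>t (\<phi> f) = 0" using r0 by blast
  qed
  have surj: "\<exists>f. x = r\<^sub>t (\<phi> f)" for x
    using res bij unfolding is_restriction_def by (metis surjD bij_pointE)
  define co where "co f = (\<chi> i. fps_nth (f $ i) 0)" for f :: "('a fps)^'n"
  have co_eq: "co f = co g \<longleftrightarrow> r\<^sub>t (\<phi> f) = r\<^sub>t (\<phi> g)" for f g
  proof -
    have "co f = co g \<longleftrightarrow> (\<forall>i. fps_nth ((f - g) $ i) 0 = 0)" by (simp add: co_def vec_eq_iff)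
    also have "\<dots> \<longleftrightarrow> r\<^sub>t (\<phi> f) = r\<^sub>t (\<phi> g)" unfolding r_\<phi>[symmetric] by (simp add: \<phi>.diff r.diff)
    finally show ?thesis .
  qed
  \<comment> \<open>Any preimage serves: by \<open>co_eq\<close> the constant terms depend only on
    the element of the fibre.\<close>
  define \<tau> where "\<tau> x = co (SOME f. x = r\<^sub>t (\<phi> f))" for x
  have \<tau>: "\<tau> (r\<^sub>t (\<phi> f)) = co f" for f
    unfolding \<tau>_def co_eq using someI[of "\<lambda>g. r\<^sub>t (\<phi> f) = r\<^sub>t (\<phi> g)" f] by simp
  have "module_hom s\<^sub>t (*s) \<tau>"
  proof (intro module_hom.intro module_vec St.module_axioms module_hom_axioms.intro)
    fix x y
    obtain f g where fg: "x = r\<^sub>t (\<phi> f)" "y = r\<^sub>t (\<phi> g)" using surj by metis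
    have "x + y = r\<^sub>t (\<phi> (f + g))" by (simp add: fg \<phi>.add r.add)
    then have "\<tau> (x + y) = co (f + g)" by (simp only: \<tau>)
    then show "\<tau> (x + y) = \<tau> x + \<tau> y" by (simp add: fg \<tau> co_def vec_eq_iff)
  next
    fix a x
    obtain f where f: "x = r\<^sub>t (\<phi> f)" using surj by metis
    have "s\<^sub>t (fps_nth (fps_const a) 0) (r\<^sub>t (\<phi> f)) = r\<^sub>t (s (fps_const a) (\<phi> f))"
      using res unfolding is_restriction_def by metis
    then have "s\<^sub>t a x = r\<^sub>t (\<phi> (fps_const a *s f))" by (simp add: f \<phi>.scale)
    then have "\<tau> (s\<^sub>t a x) = co (fps_const a *s f)" by (simp only: \<tau>)
    then show "\<tau> (s\<^sub>t a x) = a *s \<tau> x" by (simp add: f \<tau> co_def vec_eq_iff)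
  qed
  moreover have "bij \<tau>"
  proof (intro bijI injI surjI)
    fix x y assume "\<tau> x = \<tau> y"
    moreover obtain f g where "x = r\<^sub>t (\<phi> f)" "y = r\<^sub>t (\<phi> g)" using surj by metis
    ultimately show "x = y" by (simp add: \<tau> co_eq)
  next
    fix v :: "'a^'n"
    show "\<tau> (r\<^sub>t (\<phi> (\<chi> i. fps_const (v $ i)))) = v" unfolding \<tau> by (simp add: co_def vec_eq_iff)
  qed
  moreover have "\<tau> (monodromy r\<^sub>t \<delta> x) = (\<chi> i j. if i = j then - of_nat (d i) else 0) *v \<tau> x" for x
  proof -
    obtain f where f: "inv_into UNIV r\<^sub>t x = \<phi> f" using bij by (metis bij_pointE)
    have "r\<^sub>t (inv_into UNIV r\<^sub>t x) = x" using res by (simp add: is_restriction_def surj_f_inv_f)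
    then have x: "x = r\<^sub>t (\<phi> f)" by (simp add: f)
    have "\<tau> (monodromy r\<^sub>t \<delta> x) = co (delta_sum d f)"
      unfolding monodromy_def f comm[symmetric] by (rule \<tau>)
    also have "\<dots> = (\<chi> i. - of_nat (d i) * co f $ i)"
      by (simp add: co_def delta_sum_nth_0)
    also have "\<dots> = (\<chi> i j. if i = j then - of_nat (d i) else 0) *v co f"
      by (simp add: matrix_vector_mult_def vec_eq_iff if_distrib[of "\<lambda>a. a * _"] cong: if_cong)
    finally show ?thesis by (simp add: x \<tau>)
  qed
  ultimately show ?thesis by blast
qed

section \<open>Uniqueness of the exponents\<close>

lemma flat_bundle_iso_comp:
  assumes "flat_bundle_iso s \<delta> s' \<delta>' \<phi>" "flat_bundle_iso s' \<delta>' s'' \<delta>'' \<psi>"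
  shows "flat_bundle_iso s \<delta> s'' \<delta>'' (\<psi> \<circ> \<phi>)"
  using assms by (auto simp: flat_bundle_iso_def bij_comp intro: module_hom_compose)

lemma flat_bundle_iso_inverse:
  assumes "flat_bundle_iso s \<delta> s' \<delta>' \<phi>"
  shows "\<exists>\<psi>. flat_bundle_iso s' \<delta>' s \<delta> \<psi> \<and> (\<forall>x. \<psi> (\<phi> x) = x)"
proof -
  interpret \<phi>: module_hom s s' \<phi> using assms by (simp add: flat_bundle_iso_def)
  define \<psi> where "\<psi> = inv_into UNIV \<phi>"
  have bij: "bij \<phi>" and comm: "\<phi> (\<delta> v) = \<delta>' (\<phi> v)" for v
    using assms by (auto simp: flat_bundle_iso_def)
  have \<psi>: "\<psi> (\<phi> x) = x" "\<phi> (\<psi> y) = y" for x y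
    using bij by (simp_all add: \<psi>_def bij_is_inj bij_is_surj surj_f_inv_f)
  have eqI: "u = v" if "\<phi> u = \<phi> v" for u v using that \<psi>(1) by metis
  have "module_hom s' s \<psi>"
    by (intro module_hom.intro module_hom_axioms.intro \<phi>.m1.module_axioms \<phi>.m2.module_axioms; rule eqI)
      (simp_all add: \<psi> \<phi>.add \<phi>.scale)
  moreover have "bij \<psi>" unfolding \<psi>_def using bij by (rule bij_imp_bij_inv)
  moreover have "\<psi> (\<delta>' v) = \<delta> (\<psi> v)" for v by (rule eqI) (simp add: \<psi> comm)
  ultimately show ?thesis using \<psi> by (auto simp: flat_bundle_iso_def)
qed

lemma unit_det_permutation:
  fixes G :: "'a::comm_ring_1^'n::finite^'n"
  assumes loc: "nonunits_add_closed TYPE('a)" and "det G dvd 1"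
  shows "\<exists>\<sigma>. \<sigma> permutes UNIV \<and> (\<forall>i. G $ i $ \<sigma> i dvd 1)"
proof -
  obtain \<sigma> where \<sigma>: "\<sigma> permutes UNIV" "of_int (sign \<sigma>) * (\<Prod>i\<in>UNIV. G $ i $ \<sigma> i) dvd 1"
    using sum_unit[OF loc assms(2)[unfolded det_def]] by blast
  then have "(\<Prod>i\<in>UNIV. G $ i $ \<sigma> i) dvd 1" by (metis dvd_mult_right)
  then have "G $ i $ \<sigma> i dvd 1" for i
    using dvd_prodI[of UNIV i "\<lambda>i. G $ i $ \<sigma> i"] by (metis UNIV_I dvd_trans finite)
  then show ?thesis using \<sigma> by blast
qed

lemma exponents_unique:
  fixes d d' :: "'n::finite \<Rightarrow> nat"
  assumes loc: "nonunits_add_closed TYPE('a::comm_ring_1)"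
    and char: "\<And>k. 0 < k \<Longrightarrow> k < q \<Longrightarrow> (of_nat k :: 'a) \<noteq> 0"
    and d: "\<forall>i. d i < q" "\<forall>i. d' i < q"
    and T: "flat_bundle_iso ((*s) :: 'a fps \<Rightarrow> _) (delta_sum d) (*s) (delta_sum d') T"
  shows "image_mset d (mset_set UNIV) = image_mset d' (mset_set UNIV)"
proof -
  obtain T' where T': "flat_bundle_iso (*s) (delta_sum d') (*s) (delta_sum d) T'" "\<And>x. T' (T x) = x"
    using flat_bundle_iso_inverse[OF T] by blast
  interpret T: module_hom "(*s)" "(*s)" T using T by (simp add: flat_bundle_iso_def)
  interpret T': module_hom "(*s)" "(*s)" T' using T' by (simp add: flat_bundle_iso_def)
  define G :: "'a^'n^'n" where "G = (\<chi> i j. fps_nth (T (axis j 1) $ i) 0)"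
  define H :: "'a^'n^'n" where "H = (\<chi> i j. fps_nth (T' (axis j 1) $ i) 0)"
  have expand: "f = (\<Sum>j\<in>UNIV. f $ j *s axis j 1)" for f :: "('a fps)^'n"
    by (simp add: vec_eq_iff axis_def if_distrib[of "\<lambda>a. _ * a"] cong: if_cong)
  have "H ** G = mat 1"
  proof -
    have "(H ** G) $ i $ k = mat 1 $ i $ k" for i k
    proof -
      have "axis k 1 = T' (T (axis k 1))" by (simp add: T')
      also have "\<dots> = (\<Sum>j\<in>UNIV. T (axis k 1) $ j *s T' (axis j 1))"
        by (subst expand[of "T (axis k 1)"]) (simp add: T'.sum T'.scale)
      finally have ax: "axis k 1 = (\<Sum>j\<in>UNIV. T (axis k 1) $ j *s T' (axis j 1))" .
      have "fps_nth (axis k 1 $ i) 0 = (\<Sum>j\<in>UNIV. G $ j $ k * H $ i $ j)"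
        by (subst ax) (simp add: G_def H_def fps_sum_nth)
      then have "(H ** G) $ i $ k = fps_nth (axis k 1 $ i) 0"
        by (simp add: matrix_matrix_mult_def mult.commute)
      also have "\<dots> = mat 1 $ i $ k" by (simp add: axis_def mat_def)
      finally show ?thesis .
    qed
    then show ?thesis by (simp add: vec_eq_iff)
  qed
  then have "det H * det G = 1" by (metis det_mul det_I)
  then have "det G dvd 1" by (metis dvd_triv_right)
  then obtain \<sigma> where \<sigma>: "\<sigma> permutes UNIV" "\<And>i. G $ i $ \<sigma> i dvd 1"
    using unit_det_permutation[OF loc] by blast
  \<comment> \<open>The constant term at index i of the compatibility of \<open>T\<close> with the
    connections, evaluated at the unit vector of index j.\<close>
  have G: "of_nat (d j) * G $ i $ j = of_nat (d' i) * G $ i $ j" for i j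
  proof -
    have "delta_sum d (axis j 1) = - of_nat (d j) *s axis j (1 :: 'a fps)"
      by (auto simp: delta_sum_def vec_eq_iff axis_def delta_rank1_def log_deriv_def)
    moreover have "T (delta_sum d (axis j 1)) = delta_sum d' (T (axis j 1))"
      using T unfolding flat_bundle_iso_def by blast
    ultimately have "T (- of_nat (d j) *s axis j 1) = delta_sum d' (T (axis j 1))" by simp
    then have "- of_nat (d j) *s T (axis j 1) = delta_sum d' (T (axis j 1))" by (simp only: T.scale)
    from arg_cong[OF this, of "\<lambda>f. fps_nth (f $ i) 0"] show ?thesis
      by (simp add: delta_sum_nth_0 G_def of_nat_fps_mult_nth)
  qed
  have inj: "k = l" if "(of_nat k :: 'a) = of_nat l" "k \<le> l" "l < q" for k l
  proof (rule ccontr)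
    assume "k \<noteq> l"
    then have "(of_nat (l - k) :: 'a) \<noteq> 0" using that by (intro char) auto
    then show False using that by (simp add: of_nat_diff)
  qed
  have "d (\<sigma> i) = d' i" for i
  proof -
    have "(of_nat (d (\<sigma> i)) :: 'a) = of_nat (d' i)"
    proof -
      obtain u where u: "G $ i $ \<sigma> i * u = 1" using \<sigma>(2)[of i] by (auto simp: dvd_def)
      have "of_nat (d (\<sigma> i)) = of_nat (d (\<sigma> i)) * G $ i $ \<sigma> i * u" by (simp add: u mult.assoc)
      also have "\<dots> = of_nat (d' i) * G $ i $ \<sigma> i * u" by (simp only: G)
      also have "\<dots> = of_nat (d' i)" by (simp add: u mult.assoc)
      finally show ?thesis .
    qed
    then show ?thesis
      using inj[of "d (\<sigma> i)" "d' i"] inj[of "d' i" "d (\<sigma> i)"] d by (cases "d (\<sigma> i) \<le> d' i") auto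
  qed
  then have "d' = d \<circ> \<sigma>" by auto
  then have "image_mset d' (mset_set UNIV) = image_mset d (image_mset \<sigma> (mset_set UNIV))"
    by (simp add: image_mset.compositionality)
  also have "image_mset \<sigma> (mset_set UNIV) = mset_set UNIV"
    using \<sigma>(1) by (simp add: image_mset_mset_set permutes_inj permutes_surj)
  finally show ?thesis by simp
qed

text \<open>If k vanished in the base, so would gcd(k, p^(m+1)), a power of p below p^(m+1), and
  hence p^m. Flatness then makes 1 a multiple of the nilpotent p.\<close>

lemma of_nat_neq_0:
  fixes c :: "'a::comm_ring_1"
  assumes p: "Factorial_Ring.prime p"
    and flat: "flat_module (residue_ring (int p ^ (m + 1))) (\<lambda>b (x :: 'a). of_int b * x)"
    and p0: "of_nat (p ^ (m + 1)) = (0 :: 'a)"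
    and k: "0 < k" "k < p ^ (m + 1)"
  shows "(of_nat k :: 'a) \<noteq> 0"
proof
  assume k0: "(of_nat k :: 'a) = 0"
  have p1: "p > 1" using p prime_gt_1_nat by blast
  define g where "g = gcd k (p ^ (m + 1))"
  obtain x y where "int g = int k * x + int (p ^ (m + 1)) * y"
  proof -
    obtain u v where "u * int k + v * int (p ^ (m + 1)) = gcd (int k) (int (p ^ (m + 1)))"
      using bezout_int by blast
    then have "int g = int k * u + int (p ^ (m + 1)) * v"
      unfolding g_def gcd_int_int_eq by (simp only: mult.commute)
    then show thesis by (rule that)
  qed
  then have "(of_int (int g) :: 'a) = of_int (int k * x + int (p ^ (m + 1)) * y)" by (rule arg_cong)
  then have g0: "(of_nat g :: 'a) = 0"
    using k0 p0 by (simp only: of_int_of_nat_eq of_int_add of_int_mult) simp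
  have "g dvd p ^ (m + 1)" by (simp add: g_def)
  then obtain a where a: "a \<le> m + 1" "g = p ^ a" using divides_primepow_nat[OF p] by blast
  have "g \<le> k" using k by (simp add: g_def gcd_le1_nat)
  then have "a \<noteq> m + 1" using a k by auto
  then have "g dvd p ^ m" using a by (simp add: le_imp_power_dvd)
  then have "(of_nat (p ^ m) :: 'a) = 0" using g0 by (auto simp del: of_nat_power elim!: dvdE)
  then have "of_int (int p) dvd (1 :: 'a)"
    using flat_residue_ring_torsion[of "int p ^ m" "int p" "1 :: 'a"] flat p1
      one_less_power[of "int p" "Suc m"] by (simp add: mult.commute)
  then obtain z where z: "1 = of_nat p * (z :: 'a)" by (auto simp: dvd_def)
  have "1 = (of_nat p * z) ^ (m + 1)" by (simp only: z[symmetric] power_one)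
  also have "\<dots> = of_nat (p ^ (m + 1)) * z ^ (m + 1)" by (simp only: power_mult_distrib of_nat_power)
  finally show False unfolding p0 by simp
qed

theorem theorem1:
  fixes p m :: nat
    and \<pi> :: "'a::comm_ring_1 \<Rightarrow> 'r::comm_ring_1"
    and \<mm> :: "'r set"
    and s :: "'a fps \<Rightarrow> 'm::ab_group_add \<Rightarrow> 'm"
    and \<delta> :: "'m \<Rightarrow> 'm"
    and s\<^sub>0 :: "'r fps \<Rightarrow> 'v::ab_group_add \<Rightarrow> 'v"
    and r :: "'m \<Rightarrow> 'v"
    and s\<^sub>t :: "'a \<Rightarrow> 'f::ab_group_add \<Rightarrow> 'f"
    and r\<^sub>t :: "'m \<Rightarrow> 'f"
  assumes "Factorial_Ring.prime p"
    and "of_nat (p ^ (m + 1)) = (0 :: 'a)"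
    and "flat_module (residue_ring (int p ^ (m + 1))) (\<lambda>b (x :: 'a). of_int b * x)"
    and "\<pi> \<in> ring_hom ring_of_type_algebra ring_of_type_algebra"
    and "surj \<pi>"
    and "\<forall>x. \<pi> x = 0 \<longleftrightarrow> of_nat p dvd x"
    and "local_ring \<mm>"
    and "algebraically_closed (ring_of_type_algebra Quot \<mm>)"
    and "flat_bundle s \<delta> CARD('n::finite)"
    and "is_restriction (fps_map \<pi>) s s\<^sub>0 r"
    and "dormant p m s \<delta> s\<^sub>0 r"
    and "is_restriction (\<lambda>f. fps_nth f 0) s s\<^sub>t r\<^sub>t"
  shows "(\<exists>d :: 'n \<Rightarrow> nat.
      (\<forall>i. d i < p ^ (m + 1)) \<and>
      (\<exists>\<phi>. flat_bundle_iso (*s) (delta_sum d) s \<delta> \<phi>) \<and>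
      (\<exists>\<tau> :: 'f \<Rightarrow> 'a^'n. module_hom s\<^sub>t (*s) \<tau> \<and> bij \<tau> \<and>
        (\<forall>x. \<tau> (monodromy r\<^sub>t \<delta> x) = (\<chi> i j. if i = j then - of_nat (d i) else 0) *v \<tau> x))) \<and>
    (\<forall>(s' :: 'a fps \<Rightarrow> 'l::ab_group_add \<Rightarrow> 'l) \<delta>' (d :: 'n \<Rightarrow> nat) (d' :: 'n \<Rightarrow> nat).
      flat_bundle s' \<delta>' CARD('n) \<and> (\<exists>\<psi>. flat_bundle_iso s \<delta> s' \<delta>' \<psi>) \<and>
      (\<forall>i. d i < p ^ (m + 1)) \<and> (\<exists>\<phi>. flat_bundle_iso (*s) (delta_sum d) s \<delta> \<phi>) \<and>
      (\<forall>i. d' i < p ^ (m + 1)) \<and> (\<exists>\<phi>'. flat_bundle_iso (*s) (delta_sum d') s' \<delta>' \<phi>') \<longrightarrow>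
      image_mset d (mset_set UNIV) = image_mset d' (mset_set UNIV))"
proof (rule conjI)
  have p: "Factorial_Ring.prime p" and p_power_0: "of_nat (p ^ (m + 1)) = (0 :: 'a)" by fact+
  have vb: "vector_bundle s CARD('n)" and conn: "log_connection s \<delta>"
    using assms(9) by (simp_all add: flat_bundle_def)
  have mod: "Modules.module s" using vb by (simp add: vector_bundle_def)
  \<comment> \<open>The kernel of \<pi> is generated by the nilpotent p, so units of the base are
    detected in the reduction, and the base is local as well.\<close>
  have unit: "x dvd 1 \<longleftrightarrow> \<pi> x dvd 1" for x
  proof (rule unit_mod_nilpotent_iff[OF assms(4,5)])
    show "\<forall>x. \<pi> x = 0 \<longrightarrow> of_nat p dvd x" using assms(6) by blast
    show "(of_nat p :: 'a) ^ (m + 1) = 0" using p_power_0 by (simp only: of_nat_power)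
  qed
  have "\<pi> (x + y) = \<pi> x + \<pi> y" for x y
    using assms(4) by (simp add: ring_hom_def ring_of_type_algebra_def)
  then have loc: "nonunits_add_closed TYPE('a)"
    using local_ring_nonunits[OF assms(7)] by (simp add: nonunits_add_closed_def unit)
  note loc_fps = nonunits_add_closed_fps[OF loc]
  obtain e\<^sub>0 :: "'n \<Rightarrow> 'm" where e0: "basis s e\<^sub>0"
    using vector_bundle_basis[OF mod loc_fps vb] by blast
  interpret dormant_bundle p m \<pi> s \<delta> s\<^sub>0 r e\<^sub>0
    by (intro dormant_bundle.intro assms mod conn e0)
  show "\<exists>d :: 'n \<Rightarrow> nat. (\<forall>i. d i < p ^ (m + 1)) \<and>
      (\<exists>\<phi>. flat_bundle_iso (*s) (delta_sum d) s \<delta> \<phi>) \<and>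
      (\<exists>\<tau> :: 'f \<Rightarrow> 'a^'n. module_hom s\<^sub>t (*s) \<tau> \<and> bij \<tau> \<and>
        (\<forall>x. \<tau> (monodromy r\<^sub>t \<delta> x) = (\<chi> i j. if i = j then - of_nat (d i) else 0) *v \<tau> x))"
  proof -
    obtain e :: "'n \<Rightarrow> 'm" where e: "basis s e" "range e \<subseteq> {x. \<exists>c. \<delta> x = s (of_nat c) x}"
      using basis_in_spanning_set[OF mod loc_fps e0 span_eigenvectors] by blast
    then obtain c where c: "\<And>i. \<delta> (e i) = s (of_nat (c i)) (e i)"
      by (auto simp: image_subset_iff) metis
    \<comment> \<open>The rank one operator subtracts d, so d_i has to represent -c_i modulo
      p^(m+1).\<close>
    define d where "d i = (c i * (p ^ (m + 1) - 1)) mod p ^ (m + 1)" for i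
    have "\<delta> (e i) = - s (of_nat (d i)) (e i)" for i
    proof -
      have "s (of_nat (d i)) (e i) = s (of_nat (c i * (p ^ (m + 1) - 1))) (e i)"
        by (rule scale_of_nat_cong[OF mod p_power_scale_0]) (simp add: d_def unique_euclidean_semiring_class.cong_def)
      then show ?thesis by (simp only: scale_of_nat_minus c minus_minus)
    qed
    then have iso: "flat_bundle_iso (*s) (delta_sum d) s \<delta> (lincomb s e)"
      by (rule flat_bundle_iso_lincomb[OF mod conn e(1)])
    moreover have "d i < p ^ (m + 1)" for i using p_pos by (simp add: d_def)
    ultimately show ?thesis using monodromy_diagonal[OF iso assms(12)] by blast
  qed
  show "\<forall>(s' :: 'a fps \<Rightarrow> 'l \<Rightarrow> 'l) \<delta>' (d :: 'n \<Rightarrow> nat) (d' :: 'n \<Rightarrow> nat).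
      flat_bundle s' \<delta>' CARD('n) \<and> (\<exists>\<psi>. flat_bundle_iso s \<delta> s' \<delta>' \<psi>) \<and>
      (\<forall>i. d i < p ^ (m + 1)) \<and> (\<exists>\<phi>. flat_bundle_iso (*s) (delta_sum d) s \<delta> \<phi>) \<and>
      (\<forall>i. d' i < p ^ (m + 1)) \<and> (\<exists>\<phi>'. flat_bundle_iso (*s) (delta_sum d') s' \<delta>' \<phi>') \<longrightarrow>
      image_mset d (mset_set UNIV) = image_mset d' (mset_set UNIV)"
  proof (intro allI impI, elim conjE exE)
    fix s' :: "'a fps \<Rightarrow> 'l \<Rightarrow> 'l" and \<delta>' and d d' :: "'n \<Rightarrow> nat" and \<psi> \<phi> \<phi>'
    assume iso: "flat_bundle_iso s \<delta> s' \<delta>' \<psi>" "flat_bundle_iso (*s) (delta_sum d) s \<delta> \<phi>"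
      "flat_bundle_iso (*s) (delta_sum d') s' \<delta>' \<phi>'"
      and d: "\<forall>i. d i < p ^ (m + 1)" "\<forall>i. d' i < p ^ (m + 1)"
    obtain \<phi>'' where "flat_bundle_iso s' \<delta>' (*s) (delta_sum d') \<phi>''"
      using flat_bundle_iso_inverse[OF iso(3)] by blast
    then have "flat_bundle_iso (*s) (delta_sum d) (*s) (delta_sum d') (\<phi>'' \<circ> (\<psi> \<circ> \<phi>))"
      using iso by (intro flat_bundle_iso_comp)
    then show "image_mset d (mset_set UNIV) = image_mset d' (mset_set UNIV)"
      using exponents_unique[OF loc of_nat_neq_0[OF p assms(3) p_power_0] d] by blast
  qed
qed

end
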